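(* Let $G$ be a countably infinite amenable group, and let $X$ be a $G$-SFT (shift of finite type over $G$) such that $h(X)>0$. Then the set $$\{h(Y) : Y\subset X \text{ and } Y \text{ is an SFT}\}$$ is dense in the interval $[0,h(X)]$.
   Context: Let $G$ be a countably infinite group. A Følner sequence for $G$ is a sequence $(F_n)_n$ of finite subsets of $G$ such that each $g\in G$ lies in $F_n$ for all sufficiently large $n$, and $\lim_{n\to\infty} |KF_n \triangle F_n|/|F_n| = 0$ for every finite $K\subset G$, where $KF=\{kf: k\in K, f\in F\}$. $G$ is amenable if such a sequence exists. For a finite set $\mathcal A$ (alphabet, discrete topology), $\mathcal A^G$ carries the product topology and the $G$-action $(\sigma^g x)_h = x_{hg}$ for $g,h\in G$. A subshift is a closed subset $X\subset \mathcal A^G$ with $\sigma^g x\in X$ for all $x\in X$, $g\in G$ (the empty set is allowed). A pattern is a function $p:F\to\mathcal A$ with $F\subset G$ finite; it occurs in $x$ if $(\sigma^g x)|_F = p$ for some $g\in G$. $X\subset\mathcal A^G$ is a shift of finite type (SFT) if there is a finite collection $\mathcal F$ of patterns such that $X$ is the set of all $x\in\mathcal A^G$ in which no $p\in\mathcal F$ occurs. For finite $F\subset G$, let $\mathcal P(F,X)=\{(\sigma^g x)|_F : x\in X, g\in G\}$. The entropy of a nonempty subshift is $h(X)=\lim_{n\to\infty}\frac{1}{|F_n|}\log|\mathcal P(F_n,X)|$ (the limit exists and does not depend on the Følner sequence); by convention $h(\varnothing)=0$. *)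

theory Defs
  imports "HOL-Analysis.Analysis"
begin

text \<open>
  The group is the whole type \<open>'g\<close> of class \<open>group_add\<close>. This class does not assume commutativity:
  \<open>g + h\<close> stands for the product \<open>gh\<close> of an arbitrary group. The alphabet is a finite type \<open>'a\<close>.
\<close>

text \<open>
  The set \<open>K\<close> is required to be nonempty, since for \<open>K = {}\<close> the quotient is 1 as soon as \<open>F n\<close> is
  nonempty. The finitely many \<open>n\<close> with \<open>F n = {}\<close> do not affect the limit.
\<close>
definition folner_sequence :: "(nat \<Rightarrow> 'g::group_add set) \<Rightarrow> bool" where
  "folner_sequence F \<longleftrightarrow>
     (\<forall>n. finite (F n)) \<and>
     (\<forall>g. \<forall>\<^sub>F n in sequentially. g \<in> F n) \<and>
     (\<forall>K. finite K \<and> K \<noteq> {} \<longrightarrow>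
        (\<lambda>n. real (card (sym_diff {k + f |k f. k \<in> K \<and> f \<in> F n} (F n))) / real (card (F n)))
          \<longlonglongrightarrow> 0)"

definition amenable :: "'g::group_add itself \<Rightarrow> bool" where
  "amenable _ \<longleftrightarrow> (\<exists>F :: nat \<Rightarrow> 'g set. folner_sequence F)"

definition shift :: "'g::group_add \<Rightarrow> ('g \<Rightarrow> 'a) \<Rightarrow> 'g \<Rightarrow> 'a" where
  "shift g x = (\<lambda>h. x (h + g))"

definition subshift :: "('g::group_add \<Rightarrow> 'a) set \<Rightarrow> bool" where
  "subshift X \<longleftrightarrow>
     closedin (product_topology (\<lambda>_. discrete_topology UNIV) UNIV) X \<and>
     (\<forall>x\<in>X. \<forall>g. shift g x \<in> X)"

text \<open>
  A pattern \<open>p : F \<rightarrow> A\<close> is a partial map with domain \<open>F\<close>.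
\<close>
definition restriction :: "('g \<Rightarrow> 'a) \<Rightarrow> 'g set \<Rightarrow> 'g \<rightharpoonup> 'a" where
  "restriction x F = (\<lambda>h. if h \<in> F then Some (x h) else None)"

definition occurs :: "('g::group_add \<rightharpoonup> 'a) \<Rightarrow> ('g \<Rightarrow> 'a) \<Rightarrow> bool" where
  "occurs p x \<longleftrightarrow> (\<exists>g. restriction (shift g x) (dom p) = p)"

definition sft :: "('g::group_add \<Rightarrow> 'a) set \<Rightarrow> bool" where
  "sft X \<longleftrightarrow>
     (\<exists>\<F>. finite \<F> \<and> (\<forall>p\<in>\<F>. finite (dom p)) \<and> X = {x. \<forall>p\<in>\<F>. \<not> occurs p x})"

definition patterns :: "'g::group_add set \<Rightarrow> ('g \<Rightarrow> 'a) set \<Rightarrow> ('g \<rightharpoonup> 'a) set" where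
  "patterns F X = {restriction (shift g x) F |g x. x \<in> X}"

text \<open>
  The entropy is the common value of the limits along all Folner sequences. It is meaningful when
  the group is amenable and \<open>X\<close> is a subshift over a finite alphabet.
\<close>
definition entropy :: "('g::group_add \<Rightarrow> 'a) set \<Rightarrow> real" where
  "entropy X =
     (if X = {} then 0
      else THE h. \<forall>F. folner_sequence F \<longrightarrow>
        (\<lambda>n. ln (real (card (patterns (F n) X))) / real (card (F n))) \<longlonglongrightarrow> h)"

lemma shift_shift: "shift g (shift k x) = shift (g + k) x"
  by (simp add: shift_def add.assoc)

lemma sft_imp_subshift:
  fixes X :: "('g::group_add \<Rightarrow> 'a) set"
  assumes "sft X"
  shows "subshift X"
proof -
  let ?T = "product_topology (\<lambda>_. discrete_topology UNIV) UNIV :: ('g \<Rightarrow> 'a) topology"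
  obtain \<F> where fin: "\<And>p. p \<in> \<F> \<Longrightarrow> finite (dom p)"
    and X: "X = {x. \<forall>p\<in>\<F>. \<not> occurs p x}"
    using assms unfolding sft_def by blast
  have coord: "openin ?T {x. x k = a}" for k a
    using openin_continuous_map_preimage[OF continuous_map_product_projection[of k UNIV
          "\<lambda>_. discrete_topology (UNIV :: 'a set)"], of "{a}"]
    by simp
  have cyl: "openin ?T {x. restriction (shift g x) (dom p) = p}" if p: "p \<in> \<F>" for p g
  proof (cases "p = Map.empty")
    case True
    have "openin ?T (topspace ?T)" by (rule openin_topspace)
    then show ?thesis using True by (simp add: restriction_def)
  next
    case False
    have eq: "{x. restriction (shift g x) (dom p) = p}
        = (\<Inter>h\<in>dom p. {x. x (h + g) = the (p h)})"
      by (auto simp: restriction_def shift_def fun_eq_iff dom_def)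
    have "openin ?T (\<Inter>h\<in>dom p. {x. x (h + g) = the (p h)})"
      using False fin[OF p] coord by (intro openin_INT2) auto
    then show ?thesis unfolding eq .
  qed
  have "topspace ?T - X = (\<Union>p\<in>\<F>. \<Union>g. {x. restriction (shift g x) (dom p) = p})"
    unfolding X occurs_def by auto
  also have "openin ?T \<dots>"
    by (intro openin_Union ballI; clarify; intro openin_Union ballI; clarify; rule cyl)
  finally have "closedin ?T X"
    by (simp add: closedin_def)
  moreover have "shift g x \<in> X" if "x \<in> X" for x g
    using that by (auto simp: X occurs_def shift_shift)
  ultimately show ?thesis
    unfolding subshift_def by blast
qed

end

theory Submission
  imports Defs
begin

text \<open>
  The number of patterns of a set of configurations satisfies a Shearer inequality
  (lemma \<open>shearer\<close>), so that along every Folner sequence \<open>ln |P(F, Y)| / |F|\<close> converges to its infimum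
  over all finite nonempty \<open>F\<close>. This holds for an arbitrary nonempty set \<open>Y\<close> of configurations, where
  \<open>P(F, Y)\<close> records the patterns of all translates of points of \<open>Y\<close>. An infimum is an upper bound that
  can be read off from a single window: if \<open>Y\<close> lies in an SFT \<open>X\<close>, forbid in \<open>X\<close> the finitely many
  \<open>F\<close>-patterns that \<open>Y\<close> does not show, for one window \<open>F\<close> at which the quotient of \<open>Y\<close> is nearly
  its entropy. The result is an SFT between \<open>Y\<close> and \<open>X\<close> with nearly the entropy of \<open>Y\<close>. It is therefore
  enough to find arbitrary subsets of \<open>X\<close> whose entropies are dense in \<open>[0, h(X)]\<close>.

  To lower the entropy of \<open>X\<close> in small steps, fix one family of pairwise disjoint finite tiles in the
  group, with finitely many shapes up to right translation, which have small boundary and cover all but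
  a small proportion of every large Folner window (theorem \<open>ex_quasitiling\<close>). Since \<open>X\<close> is given by a
  finite window, the pattern of \<open>x \<in> X\<close> on a tile can be exchanged for any other pattern of \<open>X\<close> that agrees
  with it near the boundary of the tile, and this can be done on any set of tiles at once without leaving \<open>X\<close>.
  Choose a representative among all patterns of a shape with the same boundary values, call the others
  redundant, and forbid the redundant patterns on the tiles, one after the other. When one
  more pattern is forbidden, a point can be recovered from its modification and the
  positions of the modified tiles; when all redundant patterns are forbidden, a point is
  determined by the tiles and its values off their interiors. So each step costs little entropy, and the last
  set has little entropy, provided that there are few ways to place tiles in a window. Hence the chain of
  entropies comes close to every number in \<open>[0, h(X)]\<close>.

  That tiles can be placed in few ways is controlled by the \<open>pressure\<close>, the sum of \<open>exp (- a |P|)\<close> over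
  all shapes \<open>P\<close>: if it is at most \<open>a\<close>, then a window \<open>F\<close> contains at most \<open>exp (2 a |F|)\<close> packings by
  tiles. The tiles come from the method of Ornstein and Weiss: translates of a large invariant set are chosen
  greedily as long as they meet what is already covered in a proportion less than \<open>\<theta>\<close>, and
  each of them is then deprived of what was covered before. This covers a fixed proportion of what
  was left uncovered by an earlier family of much larger tiles, and so finitely many rounds, from large to
  small tiles, cover nearly everything. The trimmed shapes are subsets of finitely many sets \<open>S\<close> that
  omit at most \<open>\<theta> |S|\<close> points; for small \<open>\<theta>\<close> these are so few that the pressure is small.
\<close>

section \<open>Shearer's inequality for sets of partial maps\<close>

text \<open>
  The inequality of arithmetic and geometric means, as Jensen's inequality for the exponential function.
\<close>

lemma prod_root_le_mean:
  fixes y :: "'i \<Rightarrow> real"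
  assumes fin: "finite J" and card: "card J = k" and k: "k > 0"
    and nonneg: "\<And>i. i \<in> J \<Longrightarrow> y i \<ge> 0"
  shows "(\<Prod>i\<in>J. root k (y i)) \<le> (\<Sum>i\<in>J. y i) / k"
proof (cases "\<exists>i\<in>J. y i = 0")
  case True
  then have "(\<Prod>i\<in>J. root k (y i)) = 0"
    using fin k by (auto intro!: prod_zero)
  moreover have "0 \<le> (\<Sum>i\<in>J. y i) / k"
    using nonneg by (simp add: sum_nonneg)
  ultimately show ?thesis by simp
next
  case False
  then have pos: "y i > 0" if "i \<in> J" for i
    using nonneg[OF that] that by (metis less_eq_real_def)
  have ne: "J \<noteq> {}" using card k by auto
  have "(\<Prod>i\<in>J. root k (y i)) = (\<Prod>i\<in>J. exp (ln (y i) / k))"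
    using pos k by (intro prod.cong refl) (simp add: ln_root[symmetric])
  also have "\<dots> = exp (\<Sum>i\<in>J. (1 / k) *\<^sub>R ln (y i))"
    using fin by (simp add: exp_sum)
  also have "\<dots> \<le> (\<Sum>i\<in>J. (1 / k) * exp (ln (y i)))"
    using fin ne k card
    by (intro convex_on_sum[OF _ _ exp_convex]) auto
  also have "\<dots> = (\<Sum>i\<in>J. y i) / k"
    using pos by (simp add: sum_divide_distrib)
  finally show ?thesis .
qed

text \<open>
  Hoelder's inequality for \<open>k\<close> functions with all exponents \<open>k\<close>. After each of the functions is normalised
  to have sum 1, the inequality of means bounds every product by an average, and the averages add up to 1.
\<close>

lemma sum_prod_root_le:
  fixes n :: "'b \<Rightarrow> 'i \<Rightarrow> real"
  assumes finA: "finite A" and fin: "finite J" and card: "card J = k" and k: "k > 0"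
    and nonneg: "\<And>a i. n a i \<ge> 0"
  shows "(\<Sum>a\<in>A. \<Prod>i\<in>J. root k (n a i)) \<le> (\<Prod>i\<in>J. root k (\<Sum>a\<in>A. n a i))"
proof (cases "\<exists>i\<in>J. (\<Sum>a\<in>A. n a i) = 0")
  case True
  then obtain i where i: "i \<in> J" "(\<Sum>a\<in>A. n a i) = 0" by auto
  then have "n a i = 0" if "a \<in> A" for a
    using that finA nonneg by (simp add: sum_nonneg_eq_0_iff)
  then have "(\<Prod>i\<in>J. root k (n a i)) = 0" if "a \<in> A" for a
    using that i fin by (auto intro!: prod_zero bexI[of _ i])
  then have "(\<Sum>a\<in>A. \<Prod>i\<in>J. root k (n a i)) = 0" by simp
  moreover have "0 \<le> (\<Prod>i\<in>J. root k (\<Sum>a\<in>A. n a i))"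
    using nonneg by (intro prod_nonneg) (auto intro: sum_nonneg real_root_ge_zero)
  ultimately show ?thesis by simp
next
  case False
  define N where "N i = (\<Sum>a\<in>A. n a i)" for i
  have N: "N i > 0" if "i \<in> J" for i
  proof -
    have "N i \<ge> 0" unfolding N_def by (simp add: sum_nonneg nonneg)
    then show ?thesis using False that by (force simp: N_def)
  qed
  define R where "R = (\<Prod>i\<in>J. root k (N i))"
  have R: "R > 0" unfolding R_def using N k by (intro prod_pos) simp
  have "(\<Sum>a\<in>A. \<Prod>i\<in>J. root k (n a i)) = (\<Sum>a\<in>A. R * (\<Prod>i\<in>J. root k (n a i / N i)))"
  proof (intro sum.cong refl)
    fix a
    have "(\<Prod>i\<in>J. root k (n a i)) = (\<Prod>i\<in>J. root k (N i) * root k (n a i / N i))"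
      using N by (intro prod.cong refl) (force simp: real_root_mult[symmetric])
    then show "(\<Prod>i\<in>J. root k (n a i)) = R * (\<Prod>i\<in>J. root k (n a i / N i))"
      by (simp add: R_def prod.distrib)
  qed
  also have "\<dots> = R * (\<Sum>a\<in>A. \<Prod>i\<in>J. root k (n a i / N i))"
    by (simp add: sum_distrib_left)
  also have "\<dots> \<le> R * (\<Sum>a\<in>A. (\<Sum>i\<in>J. n a i / N i) / k)"
    using R fin card k nonneg N
    by (intro mult_left_mono sum_mono prod_root_le_mean) (auto intro!: divide_nonneg_pos)
  also have "(\<Sum>a\<in>A. (\<Sum>i\<in>J. n a i / N i) / k) = (\<Sum>i\<in>J. \<Sum>a\<in>A. n a i / N i) / k"
    by (subst sum.swap) (simp add: sum_divide_distrib)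
  also have "(\<Sum>i\<in>J. \<Sum>a\<in>A. n a i / N i) = (\<Sum>i\<in>J. N i / N i)"
    by (simp only: N_def sum_divide_distrib)
  also have "\<dots> = (\<Sum>i\<in>J. 1)"
    using N by (intro sum.cong refl) force
  also have "\<dots> / k = 1" using card k by simp
  finally show ?thesis by (simp add: R_def N_def)
qed

text \<open>
  Induction on \<open>F\<close>: split \<open>S\<close> by the value at one point \<open>v\<close>. The projections to the \<open>k\<close> sets that contain \<open>v\<close>
  split accordingly, which is where Hoelder's inequality applies, and the projections to the other sets
  can only shrink. The parts of \<open>S\<close> keep \<open>v\<close> in their domains, and so the lemma speaks of maps that
  agree off \<open>F\<close> instead of maps with domain \<open>F\<close>.
\<close>

theorem shearer:
  fixes S :: "('g \<rightharpoonup> 'a) set"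
  assumes "finite F" and "finite I" and "finite S" and k: "k > 0"
    and "\<And>p q u. p \<in> S \<Longrightarrow> q \<in> S \<Longrightarrow> u \<notin> F \<Longrightarrow> p u = q u"
    and "\<And>v. v \<in> F \<Longrightarrow> card {i \<in> I. v \<in> V i} = k"
  shows "real (card S) \<le> (\<Prod>i\<in>I. root k (card ((\<lambda>p. p |` V i) ` S)))"
  using assms(1,3,5,6)
proof (induction F arbitrary: S rule: finite_induct)
  case empty
  show ?case
  proof (cases "S = {}")
    case True
    then show ?thesis using k assms(2) by (auto intro!: prod_nonneg)
  next
    case False
    then obtain p where p: "p \<in> S" by blast
    have "q = p" if "q \<in> S" for q
      using empty.prems(2)[OF that p] by auto
    then have "S = {p}" using p by blast
    then show ?thesis using k by simp
  qed
next
  case (insert v F)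
  define A where "A = (\<lambda>p. p v) ` S"
  define T where "T a = {p \<in> S. p v = a}" for a
  define n where "n a i = card ((\<lambda>p. p |` V i) ` T a)" for a i
  define J where "J = {i \<in> I. v \<in> V i}"
  have finA: "finite A" and finT: "finite (T a)" for a
    using insert.prems by (auto simp: A_def T_def)
  have J: "finite J" "card J = k" "J \<subseteq> I"
    using assms(2) insert.prems(3)[of v] by (auto simp: J_def)
  have IH: "real (card (T a)) \<le> (\<Prod>i\<in>I. root k (n a i))" for a
    unfolding n_def
  proof (rule insert.IH)
    show "finite (T a)" by (rule finT)
    show "p u = q u" if "p \<in> T a" "q \<in> T a" "u \<notin> F" for p q u
      using that insert.prems(2)[of p q u] by (cases "u = v") (auto simp: T_def)
    show "card {i \<in> I. w \<in> V i} = k" if "w \<in> F" for w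
      using that insert.prems(3) by simp
  qed
  have le: "n a i \<le> card ((\<lambda>p. p |` V i) ` S)" for a i
    unfolding n_def using insert.prems(1) by (intro card_mono) (auto simp: T_def)
  have eq: "(\<Sum>a\<in>A. n a i) = card ((\<lambda>p. p |` V i) ` S)" if i: "i \<in> J" for i
  proof -
    have v: "v \<in> V i" using i by (simp add: J_def)
    have "(\<lambda>p. p |` V i) ` S = (\<Union>a\<in>A. (\<lambda>p. p |` V i) ` T a)"
      by (auto simp: A_def T_def)
    also have "card \<dots> = (\<Sum>a\<in>A. n a i)"
      unfolding n_def
    proof (rule card_UN_disjoint[OF finA])
      show "\<forall>a\<in>A. finite ((\<lambda>p. p |` V i) ` T a)" using finT by auto
      show "\<forall>a\<in>A. \<forall>b\<in>A. a \<noteq> b \<longrightarrow> (\<lambda>p. p |` V i) ` T a \<inter> (\<lambda>p. p |` V i) ` T b = {}"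
      proof (intro ballI impI equals0I, elim IntE imageE)
        fix a b r p q
        assume ne: "a \<noteq> b" and p: "r = p |` V i" "p \<in> T a" and q: "r = q |` V i" "q \<in> T b"
        have "p v = q v" using fun_cong[OF p(1), of v] fun_cong[OF q(1), of v] v by simp
        then show False using ne p(2) q(2) by (simp add: T_def)
      qed
    qed
    finally show ?thesis by simp
  qed
  have "card (\<Union>a\<in>A. T a) = (\<Sum>a\<in>A. card (T a))"
    using finT by (intro card_UN_disjoint[OF finA]) (auto simp: T_def)
  moreover have "(\<Union>a\<in>A. T a) = S" by (auto simp: A_def T_def)
  ultimately have "real (card S) = (\<Sum>a\<in>A. real (card (T a)))"
    by simp
  also have "\<dots> \<le> (\<Sum>a\<in>A. \<Prod>i\<in>I. root k (n a i))"
    by (intro sum_mono IH)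
  also have "\<dots> = (\<Sum>a\<in>A. (\<Prod>i\<in>I-J. root k (n a i)) * (\<Prod>i\<in>J. root k (n a i)))"
    using assms(2) J by (subst prod.subset_diff[of J I]) auto
  also have "\<dots> \<le> (\<Sum>a\<in>A. (\<Prod>i\<in>I-J. root k (card ((\<lambda>p. p |` V i) ` S)))
      * (\<Prod>i\<in>J. root k (n a i)))"
    using k le by (intro sum_mono mult_right_mono prod_mono prod_nonneg) auto
  also have "\<dots> = (\<Prod>i\<in>I-J. root k (card ((\<lambda>p. p |` V i) ` S)))
      * (\<Sum>a\<in>A. \<Prod>i\<in>J. root k (n a i))"
    by (simp add: sum_distrib_left)
  also have "\<dots> \<le> (\<Prod>i\<in>I-J. root k (card ((\<lambda>p. p |` V i) ` S)))
      * (\<Prod>i\<in>J. root k (\<Sum>a\<in>A. real (n a i)))"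
    using finA J k by (intro mult_left_mono sum_prod_root_le prod_nonneg) auto
  also have "(\<Prod>i\<in>J. root k (\<Sum>a\<in>A. real (n a i))) = (\<Prod>i\<in>J. root k (card ((\<lambda>p. p |` V i) ` S)))"
    by (intro prod.cong refl) (simp flip: eq)
  also have "(\<Prod>i\<in>I-J. root k (card ((\<lambda>p. p |` V i) ` S))) * \<dots>
      = (\<Prod>i\<in>I. root k (card ((\<lambda>p. p |` V i) ` S)))"
    using assms(2) J by (subst prod.subset_diff[of J I]) auto
  finally show ?case .
qed

section \<open>Boundaries and Folner sequences\<close>

definition prodset :: "'g::group_add set \<Rightarrow> 'g set \<Rightarrow> 'g set" where
  "prodset K F = {k + f |k f. k \<in> K \<and> f \<in> F}"

definition boundary :: "'g::group_add set \<Rightarrow> 'g set \<Rightarrow> 'g set" where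
  "boundary D F = {h \<in> F. \<exists>d\<in>D. d + h \<notin> F}"

lemma prodset_conv_image: "prodset K F = (\<lambda>(k, f). k + f) ` (K \<times> F)"
  by (auto simp: prodset_def)

lemma finite_prodset: "finite K \<Longrightarrow> finite F \<Longrightarrow> finite (prodset K F)"
  by (simp add: prodset_conv_image)

lemma card_prodset_le: "finite K \<Longrightarrow> finite F \<Longrightarrow> card (prodset K F) \<le> card K * card F"
  unfolding prodset_conv_image by (metis card_cartesian_product card_image_le finite_cartesian_product)

lemma boundary_subset: "boundary D F \<subseteq> F"
  by (auto simp: boundary_def)

text \<open>
  Each \<open>d \<in> D\<close> maps the points of \<open>F\<close> that it moves out of \<open>F\<close> injectively into \<open>prodset D F - F\<close>.
\<close>

lemma card_boundary_le:
  assumes "finite D" "finite F"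
  shows "card (boundary D F) \<le> card D * card (prodset D F - F)"
proof -
  have "boundary D F \<subseteq> (\<Union>d\<in>D. {h. d + h \<in> prodset D F - F})"
    by (auto simp: boundary_def prodset_def)
  moreover have fin: "finite {h. d + h \<in> prodset D F - F}"
    and card: "card {h. d + h \<in> prodset D F - F} \<le> card (prodset D F - F)" for d
  proof -
    have inj: "inj_on ((+) d) {h. d + h \<in> prodset D F - F}" by (auto simp: inj_on_def)
    have sub: "(+) d ` {h. d + h \<in> prodset D F - F} \<subseteq> prodset D F - F" by auto
    have "finite (prodset D F - F)" using assms by (simp add: finite_prodset)
    then show "finite {h. d + h \<in> prodset D F - F}"
      and "card {h. d + h \<in> prodset D F - F} \<le> card (prodset D F - F)"
      using inj_on_finite[OF inj sub] card_inj_on_le[OF inj sub] by auto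
  qed
  ultimately have "card (boundary D F) \<le> card (\<Union>d\<in>D. {h. d + h \<in> prodset D F - F})"
    using assms(1) by (intro card_mono) auto
  also have "\<dots> \<le> (\<Sum>d\<in>D. card {h. d + h \<in> prodset D F - F})"
    using assms(1) by (rule card_UN_le)
  also have "\<dots> \<le> (\<Sum>d\<in>D. card (prodset D F - F))"
    by (intro sum_mono card)
  finally show ?thesis by simp
qed

lemma folner_nonempty:
  assumes "folner_sequence F"
  shows "\<forall>\<^sub>F m in sequentially. finite (F m) \<and> F m \<noteq> {}"
proof -
  have fin: "finite (F m)" for m using assms by (simp add: folner_sequence_def)
  have "\<forall>\<^sub>F m in sequentially. 0 \<in> F m" using assms by (auto simp: folner_sequence_def)
  then show ?thesis
    by eventually_elim (use fin in auto)
qed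

lemma folner_sym_diff:
  fixes e :: real
  assumes F: "folner_sequence F" and K: "finite K" "K \<noteq> {}" and e: "e > 0"
  shows "\<forall>\<^sub>F m in sequentially. card (sym_diff (prodset K (F m)) (F m)) \<le> e * card (F m)"
proof -
  have "(\<lambda>m. real (card (sym_diff (prodset K (F m)) (F m))) / real (card (F m))) \<longlonglongrightarrow> 0"
    using F K by (auto simp: folner_sequence_def prodset_def)
  then have "\<forall>\<^sub>F m in sequentially.
      real (card (sym_diff (prodset K (F m)) (F m))) / real (card (F m)) < e"
    using e by (rule order_tendstoD(2))
  with folner_nonempty[OF F] show ?thesis
  proof eventually_elim
    case (elim m)
    then have "real (card (F m)) > 0" by (simp add: card_gt_0_iff)
    then show ?case using elim by (simp add: divide_simps)
  qed
qed

lemma folner_prodset: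
  fixes e :: real
  assumes F: "folner_sequence F" and K: "finite K" "K \<noteq> {}" and e: "e > 0"
  shows "\<forall>\<^sub>F m in sequentially. card (prodset K (F m)) \<le> (1 + e) * card (F m)"
  using folner_sym_diff[OF assms] folner_nonempty[OF F]
proof eventually_elim
  case (elim m)
  have "card (prodset K (F m)) \<le> card (F m \<union> sym_diff (prodset K (F m)) (F m))"
    using elim K by (intro card_mono) (auto simp: finite_prodset)
  also have "\<dots> \<le> card (F m) + card (sym_diff (prodset K (F m)) (F m))"
    by (rule card_Un_le)
  finally show ?case using elim(1) by (simp add: algebra_simps)
qed

lemma folner_boundary:
  fixes e :: real
  assumes F: "folner_sequence F" and D: "finite D" and e: "e > 0"
  shows "\<forall>\<^sub>F m in sequentially. card (boundary D (F m)) \<le> e * card (F m)"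
proof (cases "D = {}")
  case True
  then show ?thesis using e by (simp add: boundary_def)
next
  case False
  have cD: "real (card D) > 0" using D False by (simp add: card_gt_0_iff)
  have ec: "e / card D > 0" using e cD by simp
  show ?thesis
    using folner_sym_diff[OF F D False ec] folner_nonempty[OF F]
  proof eventually_elim
    case (elim m)
    have "real (card (boundary D (F m))) \<le> real (card D) * real (card (prodset D (F m) - F m))"
      using card_boundary_le[OF D, of "F m"] elim by (metis of_nat_le_iff of_nat_mult)
    also have "\<dots> \<le> real (card D) * (e / card D * card (F m))"
    proof (intro mult_left_mono)
      have "card (prodset D (F m) - F m) \<le> card (sym_diff (prodset D (F m)) (F m))"
        using elim D by (intro card_mono) (auto simp: finite_prodset)
      then show "real (card (prodset D (F m) - F m)) \<le> e / card D * card (F m)"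
        using elim by linarith
    qed simp
    finally show ?case using cD by simp
  qed
qed

section \<open>Entropy as an infimum over windows\<close>

lemma dom_restriction [simp]: "dom (restriction x F) = F"
  by (auto simp: restriction_def split: if_splits)

lemma finite_restrictions: 
  fixes E :: "'g set" and x :: "'g \<Rightarrow> 'a::finite"
  assumes "finite E"
  shows "finite (range (\<lambda>x :: 'g \<Rightarrow> 'a. restriction x E))"
    and "card (range (\<lambda>x :: 'g \<Rightarrow> 'a. restriction x E)) \<le> CARD('a) ^ card E"
proof -
  have eq: "range (\<lambda>x :: 'g \<Rightarrow> 'a. restriction x E) = (\<lambda>x. restriction x E) ` (E \<rightarrow>\<^sub>E UNIV)"
  proof (intro equalityI subsetI)
    fix p assume "p \<in> range (\<lambda>x :: 'g \<Rightarrow> 'a. restriction x E)"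
    then obtain x :: "'g \<Rightarrow> 'a" where "p = restriction x E" by blast
    then have "p = restriction (restrict x E) E" by (auto simp: restriction_def)
    then show "p \<in> (\<lambda>x. restriction x E) ` (E \<rightarrow>\<^sub>E UNIV)" by auto
  qed auto
  have fin: "finite (E \<rightarrow>\<^sub>E (UNIV :: 'a set))" using assms by (simp add: finite_PiE)
  show "finite (range (\<lambda>x :: 'g \<Rightarrow> 'a. restriction x E))" unfolding eq using fin by simp
  show "card (range (\<lambda>x :: 'g \<Rightarrow> 'a. restriction x E)) \<le> CARD('a) ^ card E"
    unfolding eq using card_image_le[OF fin] card_funcsetE[OF assms, of "UNIV :: 'a set"] by metis
qed

lemma finite_patterns:
  fixes X :: "('g::group_add \<Rightarrow> 'a::finite) set"
  assumes "finite F"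
  shows "finite (patterns F X)"
  by (rule finite_subset[OF _ finite_restrictions(1)[OF assms]]) (auto simp: patterns_def)

lemma card_patterns_pos:
  fixes X :: "('g::group_add \<Rightarrow> 'a::finite) set"
  assumes "finite F" "X \<noteq> {}"
  shows "card (patterns F X) \<ge> 1"
proof -
  have "patterns F X \<noteq> {}" using assms(2) by (auto simp: patterns_def)
  then show ?thesis using finite_patterns[OF assms(1), of X] by (simp add: Suc_leI card_gt_0_iff)
qed

text \<open>
  Passing to all shifts of the points of \<open>X\<close> makes the number of patterns invariant under right translation
  of the window.
\<close>

lemma card_patterns_restrict_translate:
  fixes X :: "('g::group_add \<Rightarrow> 'a::finite) set"
  assumes "finite K" and V: "V \<subseteq> (\<lambda>k. k + g) ` K"
  shows "card ((\<lambda>p. p |` V) ` patterns F X) \<le> card (patterns K X)"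
proof -
  have "(\<lambda>p. p |` V) ` patterns F X \<subseteq> (\<lambda>q h. if h \<in> V \<inter> F then q (h - g) else None) ` patterns K X"
  proof
    fix p assume "p \<in> (\<lambda>p. p |` V) ` patterns F X"
    then obtain u x where x: "x \<in> X" and p: "p = restriction (shift u x) F |` V"
      by (auto simp: patterns_def)
    have "p = (\<lambda>h. if h \<in> V \<inter> F then restriction (shift (g + u) x) K (h - g) else None)"
    proof
      fix h
      have "h - g \<in> K" if "h \<in> V" using V that by auto
      then show "p h = (if h \<in> V \<inter> F then restriction (shift (g + u) x) K (h - g) else None)"
        by (auto simp: p restriction_def restrict_map_def shift_def simp flip: add.assoc)
    qed
    then show "p \<in> (\<lambda>q h. if h \<in> V \<inter> F then q (h - g) else None) ` patterns K X"
      using x by (auto simp: patterns_def)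
  qed
  then show ?thesis
    using finite_patterns[OF assms(1), of X] by (meson card_image_le card_mono finite_imageI le_trans)
qed

text \<open>
  Shearer's inequality for the sets \<open>K + i\<close>, where \<open>i\<close> ranges over \<open>- K + F\<close>: every point of \<open>F\<close> lies
  in exactly \<open>|K|\<close> of them. For a Folner set \<open>F\<close> their number is close to \<open>|F|\<close>.
\<close>

lemma ln_card_patterns_le:
  fixes X :: "('g::group_add \<Rightarrow> 'a::finite) set"
  assumes K: "finite K" "K \<noteq> {}" and F: "finite F" and X: "X \<noteq> {}"
  shows "ln (card (patterns F X)) \<le> card (prodset (uminus ` K) F) * (ln (card (patterns K X)) / card K)"
proof -
  define I where "I = prodset (uminus ` K) F"
  define k where "k = card K"
  have k: "k > 0" using K by (simp add: k_def card_gt_0_iff)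
  have finI: "finite I" using K F by (simp add: I_def finite_prodset)
  define V where "V i = (\<lambda>k. k + i) ` K" for i
  have "real (card (patterns F X)) \<le> (\<Prod>i\<in>I. root k (card ((\<lambda>p. p |` V i) ` patterns F X)))"
  proof (rule shearer[OF F finI finite_patterns[OF F] k])
    fix p q u assume "p \<in> patterns F X" "q \<in> patterns F X" "u \<notin> F"
    then show "p u = q u" by (auto simp: patterns_def restriction_def)
  next
    fix v assume v: "v \<in> F"
    have "{i \<in> I. v \<in> V i} = (\<lambda>k. - k + v) ` K"
    proof (intro equalityI subsetI)
      fix i assume "i \<in> {i \<in> I. v \<in> V i}"
      then obtain k where "k \<in> K" "v = k + i" by (auto simp: V_def)
      then show "i \<in> (\<lambda>k. - k + v) ` K"
        by (intro image_eqI[of _ _ k]) (simp_all add: add.assoc[symmetric])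
    next
      fix i assume "i \<in> (\<lambda>k. - k + v) ` K"
      then obtain k where k: "k \<in> K" "i = - k + v" by auto
      then have "v = k + i" by (simp add: add.assoc[symmetric])
      then show "i \<in> {i \<in> I. v \<in> V i}" using k v unfolding I_def V_def prodset_def by blast
    qed
    moreover have "inj_on (\<lambda>k. - k + v) K" by (auto simp: inj_on_def)
    ultimately show "card {i \<in> I. v \<in> V i} = k" by (simp add: card_image k_def)
  qed
  also have "\<dots> \<le> (\<Prod>i\<in>I. root k (card (patterns K X)))"
    using k card_patterns_restrict_translate[OF K(1)] by (intro prod_mono) (auto simp: V_def)
  also have "\<dots> = root k (card (patterns K X)) ^ card I" by simp
  finally have le: "real (card (patterns F X)) \<le> root k (card (patterns K X)) ^ card I" .
  have pos: "real (card (patterns F X)) > 0" "real (card (patterns K X)) > 0"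
    using card_patterns_pos[OF F X] card_patterns_pos[OF K(1) X] by auto
  have "ln (card (patterns F X)) \<le> ln (root k (card (patterns K X)) ^ card I)"
    using le pos k by (subst ln_le_cancel_iff) auto
  also have "\<dots> = card I * (ln (card (patterns K X)) / k)"
    using pos k by (simp add: ln_realpow ln_root)
  finally show ?thesis by (simp add: I_def k_def)
qed

definition pattern_rate :: "('g::group_add \<Rightarrow> 'a) set \<Rightarrow> 'g set \<Rightarrow> real" where
  "pattern_rate X F = ln (real (card (patterns F X))) / real (card F)"

lemma pattern_rate_nonneg:
  fixes X :: "('g::group_add \<Rightarrow> 'a::finite) set"
  assumes "finite F" "X \<noteq> {}"
  shows "pattern_rate X F \<ge> 0"
  using card_patterns_pos[OF assms] by (simp add: pattern_rate_def)

text \<open>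
  Choose a window \<open>K\<close> at which the quotient nearly attains the infimum. By \<open>ln_card_patterns_le\<close>, the
  quotients at late Folner sets exceed the one at \<open>K\<close> at most by a factor close to 1.
\<close>

lemma pattern_rate_tendsto_Inf:
  fixes X :: "('g::group_add \<Rightarrow> 'a::finite) set"
  assumes F: "folner_sequence F" and X: "X \<noteq> {}"
  shows "(\<lambda>m. pattern_rate X (F m)) \<longlonglongrightarrow> Inf (pattern_rate X ` {K. finite K \<and> K \<noteq> {}})"
proof -
  define b where "b = Inf (pattern_rate X ` {K. finite K \<and> K \<noteq> {}})"
  have bdd: "bdd_below (pattern_rate X ` {K. finite K \<and> K \<noteq> {}})"
    using pattern_rate_nonneg[OF _ X] by (intro bdd_belowI[of _ 0]) auto
  have b0: "b \<ge> 0"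
    unfolding b_def using pattern_rate_nonneg[OF _ X] by (intro cINF_greatest) auto
  have "\<forall>\<^sub>F m in sequentially. dist (pattern_rate X (F m)) b < e" if e: "e > 0" for e
  proof -
    have "\<exists>r\<in>pattern_rate X ` {K. finite K \<and> K \<noteq> {}}. r < b + e / 2"
      unfolding b_def using e bdd by (intro cInf_lessD) (auto intro: exI[of _ "{0}"])
    then obtain K where K: "finite K" "K \<noteq> {}" and r: "pattern_rate X K < b + e / 2" by auto
    \<comment> \<open>so small that the factor \<open>1 + d\<close> adds at most \<open>e / 4\<close> to a number below \<open>b + e\<close>\<close>
    define d where "d = e / (4 * (b + e))"
    have d: "d > 0" using e b0 by (simp add: d_def)
    have mK: "finite (uminus ` K)" "uminus ` K \<noteq> {}" using K by auto
    show ?thesis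
      using folner_prodset[OF F mK d] folner_nonempty[OF F]
    proof eventually_elim
      case (elim m)
      have c: "real (card (F m)) > 0" using elim by (simp add: card_gt_0_iff)
      have "b \<le> pattern_rate X (F m)"
        unfolding b_def using elim bdd by (intro cINF_lower) auto
      moreover have "pattern_rate X (F m) \<le> (1 + d) * pattern_rate X K"
      proof -
        have "ln (card (patterns (F m) X)) \<le> card (prodset (uminus ` K) (F m)) * pattern_rate X K"
          using ln_card_patterns_le[OF K _ X] elim by (simp add: pattern_rate_def)
        also have "\<dots> \<le> ((1 + d) * card (F m)) * pattern_rate X K"
          using elim pattern_rate_nonneg[OF K(1) X] by (intro mult_right_mono) auto
        finally show ?thesis using c by (simp add: pattern_rate_def[of X "F m"] divide_simps mult_ac)
      qed
      moreover have "(1 + d) * pattern_rate X K < b + e"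
      proof -
        have "(1 + d) * pattern_rate X K \<le> (1 + d) * (b + e / 2)"
          using r d by (intro mult_left_mono) auto
        also have "\<dots> = b + e / 2 + d * (b + e / 2)" by (simp add: algebra_simps)
        also have "d * (b + e / 2) \<le> d * (b + e)"
          using d e by (intro mult_left_mono) auto
        also have "d * (b + e) = e / 4" using e b0 by (simp add: d_def divide_simps)
        finally show ?thesis using e by simp
      qed
      ultimately show ?case by (simp add: dist_real_def)
    qed
  qed
  then show ?thesis unfolding b_def[symmetric] by (rule tendstoI)
qed

lemma
  fixes X :: "('g::group_add \<Rightarrow> 'a::finite) set"
  assumes am: "amenable TYPE('g)" and X: "X \<noteq> {}"
  shows entropy_eq_Inf: "entropy X = Inf (pattern_rate X ` {K. finite K \<and> K \<noteq> {}})"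
    and entropy_limit: "folner_sequence F \<Longrightarrow> (\<lambda>m. pattern_rate X (F m)) \<longlonglongrightarrow> entropy X"
    and entropy_le_rate: "finite K \<Longrightarrow> K \<noteq> {} \<Longrightarrow> entropy X \<le> pattern_rate X K"
proof -
  let ?b = "Inf (pattern_rate X ` {K. finite K \<and> K \<noteq> {}})"
  obtain F0 :: "nat \<Rightarrow> 'g set" where F0: "folner_sequence F0"
    using am by (auto simp: amenable_def)
  have "(THE h. \<forall>F. folner_sequence F \<longrightarrow> (\<lambda>m. pattern_rate X (F m)) \<longlonglongrightarrow> h) = ?b"
  proof (rule the_equality)
    show "\<forall>F. folner_sequence F \<longrightarrow> (\<lambda>m. pattern_rate X (F m)) \<longlonglongrightarrow> ?b"
      using pattern_rate_tendsto_Inf[OF _ X] by blast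
    show "h = ?b" if "\<forall>F. folner_sequence F \<longrightarrow> (\<lambda>m. pattern_rate X (F m)) \<longlonglongrightarrow> h" for h
      using that F0 pattern_rate_tendsto_Inf[OF F0 X] LIMSEQ_unique by blast
  qed
  then show eq: "entropy X = ?b"
    using X by (simp add: entropy_def pattern_rate_def)
  show "folner_sequence F \<Longrightarrow> (\<lambda>m. pattern_rate X (F m)) \<longlonglongrightarrow> entropy X"
    unfolding eq by (rule pattern_rate_tendsto_Inf[OF _ X])
  show "finite K \<Longrightarrow> K \<noteq> {} \<Longrightarrow> entropy X \<le> pattern_rate X K"
    unfolding eq using pattern_rate_nonneg[OF _ X]
    by (intro cINF_lower bdd_belowI[of _ 0]) auto
qed

lemma entropy_nonneg:
  fixes X :: "('g::group_add \<Rightarrow> 'a::finite) set"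
  assumes am: "amenable TYPE('g)"
  shows "entropy X \<ge> 0"
proof (cases "X = {}")
  case True then show ?thesis by (simp add: entropy_def)
next
  case False
  then show ?thesis
    unfolding entropy_eq_Inf[OF am False] using pattern_rate_nonneg[OF _ False]
    by (intro cINF_greatest) auto
qed

lemma patterns_mono: "Y \<subseteq> X \<Longrightarrow> patterns F Y \<subseteq> patterns F X"
  by (auto simp: patterns_def)

lemma entropy_mono:
  fixes X Y :: "('g::group_add \<Rightarrow> 'a::finite) set"
  assumes am: "amenable TYPE('g)" and sub: "Y \<subseteq> X"
  shows "entropy Y \<le> entropy X"
proof (cases "Y = {}")
  case True then show ?thesis using entropy_nonneg[OF am, of X] by (simp add: entropy_def)
next
  case False
  then have X: "X \<noteq> {}" using sub by auto
  have "entropy Y \<le> pattern_rate X K" if K: "finite K" "K \<noteq> {}" for K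
  proof -
    have "card (patterns K Y) \<le> card (patterns K X)"
      using patterns_mono[OF sub] finite_patterns[OF K(1)] by (intro card_mono)
    then have "pattern_rate Y K \<le> pattern_rate X K"
      using card_patterns_pos[OF K(1) False]
      by (auto simp: pattern_rate_def intro!: divide_right_mono)
    then show ?thesis using entropy_le_rate[OF am False K] by simp
  qed
  then show ?thesis
    unfolding entropy_eq_Inf[OF am X] by (intro cINF_greatest) auto
qed

section \<open>Shifts of finite type\<close>

text \<open>
  The window is the union of the domains of the forbidden patterns. The local form of membership is what
  makes it possible to cut and paste points of \<open>X\<close>.
\<close>

lemma sft_window:
  fixes X :: "('g::group_add \<Rightarrow> 'a) set"
  assumes "sft X"
  obtains K where "finite K"
    and "\<And>x. (\<And>g. \<exists>y\<in>X. \<forall>k\<in>K. x (k + g) = y (k + g)) \<Longrightarrow> x \<in> X"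
proof -
  obtain \<F> where fin: "finite \<F>" "\<And>p. p \<in> \<F> \<Longrightarrow> finite (dom p)"
    and X: "X = {x. \<forall>p\<in>\<F>. \<not> occurs p x}"
    using assms unfolding sft_def by blast
  show ?thesis
  proof
    show "finite (\<Union>p\<in>\<F>. dom p)" using fin by blast
    fix x assume *: "\<And>g. \<exists>y\<in>X. \<forall>k\<in>\<Union>p\<in>\<F>. dom p. x (k + g) = y (k + g)"
    have "\<not> occurs p x" if p: "p \<in> \<F>" for p
    proof
      assume "occurs p x"
      then obtain g where g: "restriction (shift g x) (dom p) = p" by (auto simp: occurs_def)
      obtain y where y: "y \<in> X" "\<forall>k\<in>\<Union>p\<in>\<F>. dom p. x (k + g) = y (k + g)" using * by blast
      then have "restriction (shift g y) (dom p) = restriction (shift g x) (dom p)"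
        using p by (auto simp: restriction_def shift_def fun_eq_iff)
      then show False using g y(1) p X by (auto simp: occurs_def)
    qed
    then show "x \<in> X" by (simp add: X)
  qed
qed

lemma sft_shift: "sft X \<Longrightarrow> x \<in> X \<Longrightarrow> shift g x \<in> X"
  using sft_imp_subshift by (auto simp: subshift_def)

text \<open>
  Forbid the \<open>F\<close>-patterns that do not occur in \<open>Y\<close>; there are finitely many, as the alphabet is finite.
\<close>

lemma sft_outer_approximation:
  fixes X Y :: "('g::group_add \<Rightarrow> 'a::finite) set"
  assumes X: "sft X" and sub: "Y \<subseteq> X" and F: "finite F"
  obtains Z where "sft Z" "Y \<subseteq> Z" "Z \<subseteq> X" "patterns F Z = patterns F Y"
proof -
  obtain \<F> where fin: "finite \<F>" "\<And>p. p \<in> \<F> \<Longrightarrow> finite (dom p)"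
    and Xeq: "X = {x. \<forall>p\<in>\<F>. \<not> occurs p x}"
    using X unfolding sft_def by blast
  define B where "B = range (\<lambda>x :: 'g \<Rightarrow> 'a. restriction x F) - patterns F Y"
  define Z where "Z = {x. \<forall>p\<in>\<F> \<union> B. \<not> occurs p x}"
  have occ: "occurs p x \<longleftrightarrow> (\<exists>g. restriction (shift g x) F = p)" if "p \<in> B" for p x
    using that by (auto simp: B_def occurs_def)
  have "finite B" unfolding B_def by (rule finite_Diff[OF finite_restrictions(1)[OF F]])
  moreover have "finite (dom p)" if "p \<in> B" for p using that F by (auto simp: B_def)
  ultimately have "sft Z" using fin unfolding sft_def Z_def
    by (intro exI[of _ "\<F> \<union> B"]) auto
  moreover have YZ: "Y \<subseteq> Z"
    using sub by (auto simp: Z_def Xeq occ) (auto simp: B_def patterns_def)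
  moreover have "Z \<subseteq> X" by (auto simp: Z_def Xeq)
  moreover have "patterns F Z \<subseteq> patterns F Y"
  proof
    fix p assume "p \<in> patterns F Z"
    then obtain g x where x: "x \<in> Z" "p = restriction (shift g x) F" by (auto simp: patterns_def)
    show "p \<in> patterns F Y"
    proof (rule ccontr)
      assume "p \<notin> patterns F Y"
      then have "p \<in> B" using x by (auto simp: B_def)
      then show False using x occ by (auto simp: Z_def)
    qed
  qed
  ultimately show ?thesis using that patterns_mono[OF YZ] by blast
qed

section \<open>Packings by finitely many shapes\<close>

text \<open>
  A placed tile is a pair of a position and a shape. The position acts from the right, like the shift, so that it
  does not affect the invariance of the shape under multiplication from the left.
\<close>

definition tile :: "'g::group_add \<times> 'g set \<Rightarrow> 'g set" where
  "tile b = (\<lambda>p. p + fst b) ` snd b"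

definition packings :: "'g::group_add set set \<Rightarrow> 'g set \<Rightarrow> ('g \<times> 'g set) set set" where
  "packings \<S> W = {B. snd ` B \<subseteq> \<S> \<and> disjoint_family_on tile B \<and> (\<forall>b\<in>B. tile b \<subseteq> W)}"

definition pressure :: "real \<Rightarrow> 'g set set \<Rightarrow> real" where
  "pressure a \<S> = (\<Sum>P\<in>\<S>. exp (- a * card P))"

lemma inj_translate: "inj_on (\<lambda>p. p + c) P" for c :: "'g::group_add"
  by (auto simp: inj_on_def)

lemma card_tile [simp]: "card (tile b) = card (snd b)"
  unfolding tile_def by (rule card_image[OF inj_translate])

lemma finite_tile [simp]: "finite (tile b) \<longleftrightarrow> finite (snd b)"
  unfolding tile_def by (rule finite_image_iff[OF inj_translate])

lemma mem_tile: "h \<in> tile (c, P) \<longleftrightarrow> h - c \<in> P"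
proof
  assume "h - c \<in> P"
  then show "h \<in> tile (c, P)"
    unfolding tile_def by (intro image_eqI[of _ _ "h - c"]) auto
qed (auto simp: tile_def)

lemma add_mem_tile [simp]: "i + c \<in> tile (c, P) \<longleftrightarrow> i \<in> P"
  by (simp add: mem_tile)

lemma prodset_tile: "prodset K (tile (c, P)) = (\<lambda>h. h + c) ` prodset K P"
proof -
  have "k + (p + c) = (k + p) + c" for k p by (simp add: add.assoc)
  then show ?thesis unfolding prodset_def tile_def image_def by (auto; metis)
qed

lemma finite_packing_placements:
  assumes W: "finite W" and P: "P \<noteq> {}"
  shows "finite {c. tile (c, P) \<subseteq> W}" and "card {c. tile (c, P) \<subseteq> W} \<le> card W"
proof -
  obtain p where p: "p \<in> P" using P by blast
  have sub: "(+) p ` {c. tile (c, P) \<subseteq> W} \<subseteq> W"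
    using p by (auto simp: tile_def)
  have inj: "inj_on ((+) p) {c. tile (c, P) \<subseteq> W}" by (auto simp: inj_on_def)
  show "finite {c. tile (c, P) \<subseteq> W}" and "card {c. tile (c, P) \<subseteq> W} \<le> card W"
    using inj_on_finite[OF inj sub W] card_inj_on_le[OF inj sub W] by auto
qed

text \<open>
  Give each placed tile \<open>b\<close> the weight \<open>exp (- a |b|)\<close>. A packing of \<open>W\<close> covers at most \<open>|W|\<close> points, so the
  product of its weights is at least \<open>exp (- a |W|)\<close>. The sum of these products over all sets of placed
  tiles is a product of factors \<open>1 + w b \<le> exp (w b)\<close>, and each shape has at most \<open>|W|\<close> positions inside \<open>W\<close>.
\<close>

lemma
  assumes W: "finite W" and S: "finite \<S>" "{} \<notin> \<S>" and a: "a \<ge> 0"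
  shows finite_packings: "finite (packings \<S> W)"
    and packing_finite: "B \<in> packings \<S> W \<Longrightarrow> finite B"
    and card_packings_le: "card (packings \<S> W) \<le> exp ((a + pressure a \<S>) * card W)"
proof -
  define \<Omega> where "\<Omega> = (\<lambda>(P, c). (c, P)) ` Sigma \<S> (\<lambda>P. {c. tile (c, P) \<subseteq> W})"
  define w :: "'a \<times> 'a set \<Rightarrow> real" where "w b = exp (- a * card (snd b))" for b
  have fin1: "finite {c. tile (c, P) \<subseteq> W}" if "P \<in> \<S>" for P
    using finite_packing_placements(1)[OF W] S(2) that by metis
  have fin: "finite \<Omega>" using S(1) fin1 by (auto simp: \<Omega>_def)
  have sub: "packings \<S> W \<subseteq> Pow \<Omega>"
    by (force simp: packings_def \<Omega>_def)
  show finP: "finite (packings \<S> W)" using sub fin by (auto intro: finite_subset)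
  show finB: "finite B" if "B \<in> packings \<S> W" for B using sub fin that by (auto intro: finite_subset)
  have w_ge: "exp (- a * card W) \<le> (\<Prod>b\<in>B. w b)" if B: "B \<in> packings \<S> W" for B
  proof -
    have tiles: "finite (tile b)" if "b \<in> B" for b
      using B that W by (auto simp: packings_def intro: finite_subset simp del: finite_tile)
    have "(\<Sum>b\<in>B. card (snd b)) = card (\<Union>b\<in>B. tile b)"
      using B finB[OF B] tiles
      by (subst card_UN_disjoint) (auto simp: packings_def disjoint_family_on_def)
    also have "\<dots> \<le> card W"
      using B W by (intro card_mono) (auto simp: packings_def)
    finally have le: "(\<Sum>b\<in>B. card (snd b)) \<le> card W" .
    have "(\<Prod>b\<in>B. w b) = exp (- a * (\<Sum>b\<in>B. card (snd b)))"
      using finB[OF B] by (simp add: w_def exp_sum[symmetric] sum_distrib_left sum_negf)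
    moreover have "a * (\<Sum>b\<in>B. card (snd b)) \<le> a * card W"
      using le a by (intro mult_left_mono of_nat_mono) auto
    ultimately show ?thesis by simp
  qed
  have "card (packings \<S> W) * exp (- a * card W) = (\<Sum>B\<in>packings \<S> W. exp (- a * card W))"
    by simp
  also have "\<dots> \<le> (\<Sum>B\<in>packings \<S> W. \<Prod>b\<in>B. w b)"
    by (intro sum_mono w_ge)
  also have "\<dots> \<le> (\<Sum>B\<in>Pow \<Omega>. \<Prod>b\<in>B. w b)"
    using sub fin by (intro sum_mono2) (auto intro!: prod_nonneg simp: w_def)
  also have "\<dots> = (\<Prod>b\<in>\<Omega>. w b + 1)"
    using fin by (subst prod_add) auto
  also have "\<dots> \<le> (\<Prod>b\<in>\<Omega>. exp (w b))"
    by (intro prod_mono) (auto simp: w_def add.commute intro: add_nonneg_nonneg)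
  also have "\<dots> = exp (\<Sum>b\<in>\<Omega>. w b)"
    using fin by (simp add: exp_sum)
  also have "(\<Sum>b\<in>\<Omega>. w b) = (\<Sum>P\<in>\<S>. \<Sum>c | tile (c, P) \<subseteq> W. exp (- a * card P))"
  proof -
    have "inj_on (\<lambda>(P, c). (c, P)) A" for A :: "('a set \<times> 'a) set" by (auto simp: inj_on_def)
    then have "(\<Sum>b\<in>\<Omega>. w b) = (\<Sum>(P, c)\<in>Sigma \<S> (\<lambda>P. {c. tile (c, P) \<subseteq> W}). exp (- a * card P))"
      unfolding \<Omega>_def by (subst sum.reindex) (auto simp: w_def intro!: sum.cong)
    also have "\<dots> = (\<Sum>P\<in>\<S>. \<Sum>c | tile (c, P) \<subseteq> W. exp (- a * card P))"
      using S(1) fin1 by (subst sum.Sigma) auto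
    finally show ?thesis .
  qed
  also have "\<dots> \<le> (\<Sum>P\<in>\<S>. card W * exp (- a * card P))"
  proof (intro sum_mono)
    fix P assume "P \<in> \<S>"
    then have "card {c. tile (c, P) \<subseteq> W} \<le> card W"
      using finite_packing_placements(2)[OF W] S(2) by metis
    then show "(\<Sum>c | tile (c, P) \<subseteq> W. exp (- a * card P)) \<le> card W * exp (- a * card P)"
      by (simp add: mult_right_mono)
  qed
  also have "\<dots> = card W * pressure a \<S>"
    by (simp only: pressure_def sum_distrib_left)
  finally have "card (packings \<S> W) * exp (- a * card W) \<le> exp (pressure a \<S> * card W)"
    by (simp add: mult.commute)
  then show "card (packings \<S> W) \<le> exp ((a + pressure a \<S>) * card W)"
    by (simp add: exp_minus exp_add ring_distribs divide_simps mult_ac)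
qed

section \<open>Shapes that nearly fill a given set\<close>

definition almost_full :: "real \<Rightarrow> 'g set \<Rightarrow> 'g set set" where
  "almost_full \<theta> S = {P. P \<subseteq> S \<and> real (card (S - P)) \<le> \<theta> * real (card S)}"

lemma finite_almost_full: "finite S \<Longrightarrow> finite (almost_full \<theta> S)"
  unfolding almost_full_def by (rule finite_subset[of _ "Pow S"]) auto

lemma card_almost_full_member:
  fixes \<theta> :: real
  assumes "finite S" "P \<in> almost_full \<theta> S"
  shows "(1 - \<theta>) * card S \<le> card P"
proof -
  have "card S = card P + card (S - P)"
    using assms by (subst card_Un_disjoint[symmetric])
      (auto simp: almost_full_def intro: finite_subset intro!: arg_cong[of _ _ card])
  then show ?thesis using assms(2) by (simp add: almost_full_def algebra_simps)
qed

text \<open>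
  The usual entropy bound for sums of binomial coefficients: a subset that omits at most \<open>\<theta> |S|\<close> points has weight at
  least \<open>\<theta> powr (\<theta> |S|)\<close> in the expansion of \<open>(1 + \<theta>) ^ |S|\<close>.
\<close>

lemma card_almost_full_le:
  fixes \<theta> :: real
  assumes S: "finite S" and th: "0 < \<theta>" "\<theta> \<le> 1"
  shows "card (almost_full \<theta> S) \<le> exp ((\<theta> - \<theta> * ln \<theta>) * card S)"
proof -
  have "card (almost_full \<theta> S) * exp (\<theta> * card S * ln \<theta>)
      = (\<Sum>P\<in>almost_full \<theta> S. exp (\<theta> * card S * ln \<theta>))" by simp
  also have "\<dots> \<le> (\<Sum>P\<in>almost_full \<theta> S. \<theta> ^ card (S - P))"
  proof (intro sum_mono)
    fix P assume "P \<in> almost_full \<theta> S"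
    then have "(\<theta> * card S) * ln \<theta> \<le> card (S - P) * ln \<theta>"
      using th by (intro mult_right_mono_neg) (auto simp: almost_full_def)
    then have "exp (\<theta> * card S * ln \<theta>) \<le> exp (card (S - P) * ln \<theta>)" by simp
    also have "\<dots> = \<theta> ^ card (S - P)" using th by (simp add: exp_of_nat_mult)
    finally show "exp (\<theta> * card S * ln \<theta>) \<le> \<theta> ^ card (S - P)" .
  qed
  also have "\<dots> \<le> (\<Sum>P\<in>Pow S. \<theta> ^ card (S - P))"
    using S th by (intro sum_mono2) (auto simp: almost_full_def)
  also have "\<dots> = (\<Prod>s\<in>S. 1 + \<theta>)"
    using S by (subst prod_add) auto
  also have "\<dots> \<le> (\<Prod>s\<in>S. exp \<theta>)"
    using th by (intro prod_mono) auto
  also have "\<dots> = exp (\<theta> * card S)"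
    by (simp add: exp_of_nat_mult[symmetric] mult.commute)
  finally show ?thesis
    by (simp add: right_diff_distrib left_diff_distrib exp_diff pos_le_divide_eq mult_ac)
qed

text \<open>
  Each of the shapes has at least \<open>|S| / 2\<close> points and so contributes at most \<open>exp (- a |S| / 2)\<close>, and there are
  at most \<open>exp (a |S| / 4)\<close> of them.
\<close>

lemma pressure_almost_full_le:
  fixes \<theta> :: real
  assumes S: "finite S" and th: "0 < \<theta>" "\<theta> \<le> 1 / 2" and a: "a > 0" "\<theta> - \<theta> * ln \<theta> \<le> a / 4"
  shows "pressure a (almost_full \<theta> S) \<le> exp (- (a / 4) * card S)"
proof -
  have "pressure a (almost_full \<theta> S) \<le> (\<Sum>P\<in>almost_full \<theta> S. exp (- (a / 2) * card S))"
    unfolding pressure_def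
  proof (intro sum_mono)
    fix P assume "P \<in> almost_full \<theta> S"
    from card_almost_full_member[OF S this]
    have "card P \<ge> (1 - \<theta>) * card S" .
    moreover have "(1 - \<theta>) * card S \<ge> 1 / 2 * card S"
      using th by (intro mult_right_mono) auto
    ultimately have "a * (1 / 2 * card S) \<le> a * card P" using a by (intro mult_left_mono) auto
    then show "exp (- a * card P) \<le> exp (- (a / 2) * card S)" by simp
  qed
  also have "\<dots> = card (almost_full \<theta> S) * exp (- (a / 2) * card S)" by simp
  also have "\<dots> \<le> exp ((\<theta> - \<theta> * ln \<theta>) * card S) * exp (- (a / 2) * card S)"
    using card_almost_full_le[OF S, of \<theta>] th by (intro mult_right_mono) auto
  also have "\<dots> \<le> exp (a / 4 * card S) * exp (- (a / 2) * card S)"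
    using a by (intro mult_right_mono iffD2[OF exp_le_cancel_iff]) auto
  also have "\<dots> = exp (- (a / 4) * card S)"
    by (simp add: exp_add[symmetric])
  finally show ?thesis .
qed

section \<open>Quasitilings\<close>

text \<open>
  Run through all \<open>g\<close> in the group, and add the translate \<open>S + g\<close> whenever less than the proportion \<open>\<theta>\<close> of it
  has been covered before; the new tile consists of the points of \<open>S + g\<close> not covered before. A rejected
  translate is covered in the proportion \<open>\<theta>\<close> by what led to its rejection, and an accepted one completely.
\<close>

lemma greedy_tiling:
  fixes S U0 :: "'g::group_add set" and \<theta> :: real
  assumes count: "countable (UNIV :: 'g set)" and S: "finite S" and th: "0 < \<theta>" "\<theta> \<le> 1"
  obtains \<Theta> where "snd ` \<Theta> \<subseteq> almost_full \<theta> S" "disjoint_family_on tile \<Theta>"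
    "U0 \<inter> (\<Union>b\<in>\<Theta>. tile b) = {}"
    "\<And>g. \<theta> * card S \<le> card (tile (g, S) \<inter> (U0 \<union> (\<Union>b\<in>\<Theta>. tile b)))"
proof -
  define e where "e = from_nat_into (UNIV :: 'g set)"
  define step where "step n V =
    (if card (tile (e n, S) \<inter> V) < \<theta> * card S then V \<union> tile (e n, S) else V)" for n V
  define U where "U = rec_nat U0 step"
  define sel where "sel = {n. card (tile (e n, S) \<inter> U n) < \<theta> * card S}"
  define b where "b n = (e n, {s \<in> S. s + e n \<notin> U n})" for n
  have U0: "U 0 = U0" and USuc: "U (Suc n) = step n (U n)" for n by (simp_all add: U_def)
  have mono: "U n \<subseteq> U m" if "n \<le> m" for n m
    using that by (rule lift_Suc_mono_le[rotated]) (auto simp: USuc step_def)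
  have tile_b: "tile (b n) = tile (e n, S) - U n" for n
    by (auto simp: tile_def b_def)
  have tile_sub: "tile (b n) \<subseteq> U (Suc n)" if "n \<in> sel" for n
    using that by (auto simp: tile_b USuc step_def sel_def)
  have disj: "tile (b n) \<inter> tile (b m) = {}" if "n \<in> sel" "n < m" for n m
    using tile_sub[OF that(1)] mono[of "Suc n" m] that(2) by (auto simp: tile_b)
  let ?\<Theta> = "b ` sel"
  have Usub: "U n \<subseteq> U0 \<union> (\<Union>b\<in>?\<Theta>. tile b)" for n
  proof (induction n)
    case (Suc n)
    show ?case
    proof (cases "n \<in> sel")
      case True
      then have "U (Suc n) = U n \<union> tile (b n)" by (auto simp: USuc step_def sel_def tile_b)
      then show ?thesis using Suc True by auto
    next
      case False
      then have "U (Suc n) = U n" by (simp add: USuc step_def sel_def)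
      then show ?thesis using Suc by simp
    qed
  qed (simp add: U0)
  show ?thesis
  proof
    show "snd ` ?\<Theta> \<subseteq> almost_full \<theta> S"
    proof (rule image_subsetI, elim imageE)
      fix x n assume n: "n \<in> sel" and x: "x = b n"
      have "tile (e n, S) \<inter> U n = (\<lambda>s. s + e n) ` (S - snd (b n))"
        by (auto simp: tile_def b_def)
      then have "card (S - snd (b n)) = card (tile (e n, S) \<inter> U n)"
        by (simp add: card_image[OF inj_translate])
      then show "snd x \<in> almost_full \<theta> S"
        using n x by (auto simp: almost_full_def sel_def b_def)
    qed
    show "disjoint_family_on tile ?\<Theta>"
      unfolding disjoint_family_on_def
    proof (intro ballI impI)
      fix x y assume "x \<in> ?\<Theta>" "y \<in> ?\<Theta>" "x \<noteq> y"
      then obtain n m where nm: "n \<in> sel" "m \<in> sel" "n \<noteq> m" "x = b n" "y = b m" by blast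
      then show "tile x \<inter> tile y = {}" using disj[of n m] disj[of m n] by (cases "n < m") auto
    qed
    show "U0 \<inter> (\<Union>b\<in>?\<Theta>. tile b) = {}"
      using mono[of 0] by (auto simp: tile_b U0)
    fix g
    obtain n where n: "g = e n"
      using from_nat_into_surj[OF count, of g] by (auto simp: e_def)
    let ?V = "U0 \<union> (\<Union>b\<in>?\<Theta>. tile b)"
    show "\<theta> * card S \<le> card (tile (g, S) \<inter> ?V)"
    proof (cases "n \<in> sel")
      case True
      then have "tile (g, S) \<subseteq> U (Suc n)" by (auto simp: n USuc step_def sel_def)
      then have "tile (g, S) \<inter> ?V = tile (g, S)" using Usub[of "Suc n"] by blast
      then show ?thesis using th by (simp add: mult_left_le_one_le)
    next
      case False
      then have "\<theta> * card S \<le> card (tile (g, S) \<inter> U n)" by (simp add: sel_def n)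
      also have "\<dots> \<le> card (tile (g, S) \<inter> ?V)"
        using Usub[of n] S by (intro of_nat_mono card_mono) auto
      finally show ?thesis .
    qed
  qed
qed

text \<open>
  The steps that lead from one point of a tile to another. A tile that meets \<open>W\<close> off the boundary
  of \<open>W\<close> with respect to these steps lies inside \<open>W\<close>.
\<close>

definition differences :: "'g::group_add set set \<Rightarrow> 'g set" where
  "differences \<S> = (\<Union>P\<in>\<S>. (\<lambda>(q, p). q - p) ` (P \<times> P))"

lemma finite_differences: "finite \<S> \<Longrightarrow> (\<And>P. P \<in> \<S> \<Longrightarrow> finite P) \<Longrightarrow> finite (differences \<S>)"
  by (auto simp: differences_def)

lemma tile_subset_or_boundary:
  assumes P: "P \<in> \<S>" and h: "h \<in> tile (c, P)" "h \<in> W" "h \<notin> boundary (differences \<S>) W"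
  shows "tile (c, P) \<subseteq> W"
proof
  fix h' assume "h' \<in> tile (c, P)"
  then obtain q where q: "q \<in> P" "h' = q + c" by (auto simp: tile_def)
  obtain p where p: "p \<in> P" "h = p + c" using h(1) by (auto simp: tile_def)
  have "q - p \<in> differences \<S>" using P p q by (auto simp: differences_def)
  moreover have "(q - p) + h = h'" by (simp add: p q add.assoc[symmetric])
  ultimately show "h' \<in> W" using h(2,3) by (auto simp: boundary_def)
qed

text \<open>
  The translates \<open>S + h\<close> that are blocked because they meet a tile have \<open>h \<in> - S + U\<close>. As the tiles
  are invariant under \<open>- S\<close>, this set is hardly larger than \<open>U\<close>, up to tiles that stick out of the window.
\<close>

lemma card_blocked_le:
  fixes W S :: "'g::group_add set" and \<epsilon> :: real
  assumes W: "finite W" and S: "finite S"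
    and shapes: "finite \<S>" "\<And>P. P \<in> \<S> \<Longrightarrow> finite P \<and> P \<noteq> {}"
    and inv: "\<And>P. P \<in> \<S> \<Longrightarrow> card (prodset (uminus ` S) P) \<le> (1 + \<epsilon>) * card P"
    and \<Theta>: "snd ` \<Theta> \<subseteq> \<S>" "disjoint_family_on tile \<Theta>" and eps: "\<epsilon> \<ge> 0"
  defines "U \<equiv> (\<Union>b\<in>\<Theta>. tile b)"
  shows "card {h \<in> W. tile (h, S) \<inter> (U \<inter> W) \<noteq> {}}
    \<le> (1 + \<epsilon>) * card (U \<inter> W) + real (card S) * real (card (boundary (differences \<S>) W))"
proof -
  let ?bd = "boundary (differences \<S>) W" and ?S = "uminus ` S"
  define B where "B = {b \<in> \<Theta>. tile b \<subseteq> W}"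
  have pack: "B \<in> packings \<S> W"
    using \<Theta> by (auto simp: B_def packings_def disjoint_family_on_def)
  have finB: "finite B"
    using packing_finite[OF W shapes(1) _ _ pack, of 0] shapes(2) by auto
  have shapeB: "snd b \<in> \<S>" if "b \<in> B" for b using that \<Theta>(1) by (auto simp: B_def)
  have finbd: "finite ?bd" using W boundary_subset finite_subset by metis
  have cover: "U \<inter> W \<subseteq> (\<Union>b\<in>B. tile b) \<union> ?bd"
  proof
    fix h assume h: "h \<in> U \<inter> W"
    then obtain b where b: "b \<in> \<Theta>" "h \<in> tile b" by (auto simp: U_def)
    then have "tile b \<subseteq> W \<or> h \<in> ?bd"
      using tile_subset_or_boundary[of "snd b" \<S> h "fst b" W] \<Theta>(1) h by auto
    then show "h \<in> (\<Union>b\<in>B. tile b) \<union> ?bd" using b unfolding B_def by blast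
  qed
  have "{h \<in> W. tile (h, S) \<inter> (U \<inter> W) \<noteq> {}} \<subseteq> (\<Union>b\<in>B. prodset ?S (tile b)) \<union> prodset ?S ?bd"
  proof (rule subsetI, rule ccontr)
    fix h assume "h \<in> {h \<in> W. tile (h, S) \<inter> (U \<inter> W) \<noteq> {}}"
    then obtain u where h: "h \<in> W" "u \<in> tile (h, S)" "u \<in> U" "u \<in> W" by blast
    assume nh: "h \<notin> (\<Union>b\<in>B. prodset ?S (tile b)) \<union> prodset ?S ?bd"
    obtain s where s: "s \<in> S" "u = s + h" using h(2) by (auto simp: tile_def)
    have hu: "h = - s + u" by (simp add: s add.assoc[symmetric])
    have "u \<notin> ?bd" using nh s(1) hu by (auto simp: prodset_def)
    then obtain b where "b \<in> B" "u \<in> tile b" using cover h(3,4) by blast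
    then show False using nh s(1) hu by (auto simp: prodset_def)
  qed
  moreover have fin: "finite (prodset ?S (tile b))" if "b \<in> B" for b
    using S shapes(2)[OF shapeB[OF that]] by (simp add: finite_prodset)
  moreover have "finite (prodset ?S ?bd)" using S finbd by (simp add: finite_prodset)
  ultimately have "card {h \<in> W. tile (h, S) \<inter> (U \<inter> W) \<noteq> {}}
      \<le> card ((\<Union>b\<in>B. prodset ?S (tile b)) \<union> prodset ?S ?bd)"
    using finB by (intro card_mono) auto
  also have "\<dots> \<le> card (\<Union>b\<in>B. prodset ?S (tile b)) + card (prodset ?S ?bd)"
    by (rule card_Un_le)
  also have "\<dots> \<le> (\<Sum>b\<in>B. card (prodset ?S (tile b))) + card S * card ?bd"
    using card_UN_le[OF finB, of "\<lambda>b. prodset ?S (tile b)"] card_prodset_le[of ?S ?bd] S finbd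
    by (simp add: card_image add_mono)
  finally have "real (card {h \<in> W. tile (h, S) \<inter> (U \<inter> W) \<noteq> {}})
      \<le> (\<Sum>b\<in>B. real (card (prodset ?S (tile b)))) + real (card S) * real (card ?bd)"
    by (simp flip: of_nat_sum of_nat_mult of_nat_add)
  also have "(\<Sum>b\<in>B. real (card (prodset ?S (tile b)))) \<le> (\<Sum>b\<in>B. (1 + \<epsilon>) * card (tile b))"
  proof (intro sum_mono)
    fix b assume b: "b \<in> B"
    have "card (prodset ?S (tile b)) = card (prodset ?S (snd b))"
      using prodset_tile[of ?S "fst b" "snd b"] by (simp add: card_image[OF inj_translate])
    then show "real (card (prodset ?S (tile b))) \<le> (1 + \<epsilon>) * card (tile b)"
      using inv[OF shapeB[OF b]] by simp
  qed
  also have "\<dots> = (1 + \<epsilon>) * card (\<Union>b\<in>B. tile b)"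
  proof -
    have "card (\<Union>b\<in>B. tile b) = (\<Sum>b\<in>B. card (tile b))"
      using finB pack shapes(2)[OF shapeB]
      by (intro card_UN_disjoint) (auto simp: packings_def disjoint_family_on_def)
    then show ?thesis by (simp add: sum_distrib_left)
  qed
  also have "\<dots> \<le> (1 + \<epsilon>) * card (U \<inter> W)"
    using W eps by (intro mult_left_mono of_nat_mono card_mono) (auto simp: B_def U_def)
  finally show ?thesis by simp
qed

text \<open>
  Double counting of the pairs of a translate \<open>S + h\<close> that is not blocked and a point of \<open>V\<close> on it:
  each such translate contains at least \<open>\<theta> |S|\<close> points of \<open>V\<close>, and each point lies on at most \<open>|S|\<close> translates.
\<close>

lemma card_new_ge:
  fixes W S U V :: "'g::group_add set" and \<theta> :: real
  assumes W: "finite W" and S: "finite S" "S \<noteq> {}"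
    and dense: "\<And>h. tile (h, S) \<inter> U = {} \<Longrightarrow> \<theta> * card S \<le> card (tile (h, S) \<inter> V)"
    and th: "\<theta> > 0"
  shows "\<theta> * (real (card W) - card (boundary S W) - card {h \<in> W. tile (h, S) \<inter> (U \<inter> W) \<noteq> {}})
    \<le> card (V \<inter> W)"
proof -
  define A where "A = {h \<in> W. tile (h, S) \<inter> (U \<inter> W) \<noteq> {}}"
  define H where "H = W - boundary S W - A"
  have finH: "finite H" and finA: "finite A" using W by (auto simp: H_def A_def)
  have "card W \<le> card (H \<union> boundary S W \<union> A)"
    using W finH finA boundary_subset[of S W] by (intro card_mono) (auto simp: H_def intro: finite_subset)
  also have "\<dots> \<le> card H + card (boundary S W) + card A"
    by (meson add_mono card_Un_le le_refl le_trans)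
  finally have cH: "real (card W) - card (boundary S W) - card A \<le> card H" by linarith
  have tW: "tile (h, S) \<subseteq> W" if "h \<in> H" for h
    using that by (auto simp: H_def boundary_def tile_def)
  have "real (card H) * (\<theta> * card S) = (\<Sum>h\<in>H. \<theta> * card S)" by simp
  also have "\<dots> \<le> (\<Sum>h\<in>H. real (card (tile (h, S) \<inter> V)))"
  proof (intro sum_mono dense)
    fix h assume h: "h \<in> H"
    then show "tile (h, S) \<inter> U = {}" using tW[OF h] by (auto simp: H_def A_def)
  qed
  also have "\<dots> = card (Sigma H (\<lambda>h. tile (h, S) \<inter> V))"
    using finH S by (subst card_SigmaI) auto
  also have "\<dots> \<le> card (S \<times> (V \<inter> W))"
  proof -
    have "inj_on (\<lambda>(h, u). (u - h, u)) (Sigma H (\<lambda>h. tile (h, S) \<inter> V))"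
      by (auto simp: inj_on_def diff_conv_add_uminus simp del: add_uminus_conv_diff)
    moreover have "(\<lambda>(h, u). (u - h, u)) ` (Sigma H (\<lambda>h. tile (h, S) \<inter> V)) \<subseteq> S \<times> (V \<inter> W)"
      using tW by (force simp: mem_tile)
    ultimately have "card (Sigma H (\<lambda>h. tile (h, S) \<inter> V)) \<le> card (S \<times> (V \<inter> W))"
      using W S by (intro card_inj_on_le) auto
    then show ?thesis by simp
  qed
  also have "\<dots> = real (card (V \<inter> W)) * card S" by (simp add: card_cartesian_product)
  finally have "(\<theta> * card H) * card S \<le> real (card (V \<inter> W)) * card S" by (simp add: mult_ac)
  moreover have "real (card S) > 0" using S by (simp add: card_gt_0_iff)
  ultimately have "\<theta> * card H \<le> card (V \<inter> W)" by (simp only: mult_le_cancel_right_pos)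
  moreover have "\<theta> * (real (card W) - card (boundary S W) - card A) \<le> \<theta> * card H"
    using cH th by (intro mult_left_mono) auto
  ultimately show ?thesis unfolding A_def by linarith
qed

definition quasitiling ::
    "'g::group_add set \<Rightarrow> real \<Rightarrow> real \<Rightarrow> real \<Rightarrow> ('g \<times> 'g set) set \<Rightarrow> bool" where
  "quasitiling L \<epsilon> a \<kappa> \<Theta> \<longleftrightarrow>
     finite (snd ` \<Theta>) \<and>
     (\<forall>P\<in>snd ` \<Theta>. finite P \<and> P \<noteq> {} \<and> card (prodset L P) \<le> (1 + \<epsilon>) * real (card P)) \<and>
     disjoint_family_on tile \<Theta> \<and> pressure a (snd ` \<Theta>) \<le> \<kappa>"

text \<open>
  A uniform lower density: the bound holds for all right translates of a late Folner set.
\<close>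

definition covers :: "(nat \<Rightarrow> 'g::group_add set) \<Rightarrow> real \<Rightarrow> ('g \<times> 'g set) set \<Rightarrow> bool" where
  "covers F u \<Theta> \<longleftrightarrow> (\<forall>\<^sub>F m in sequentially. \<forall>g.
     u * real (card (F m)) \<le> card (tile (g, F m) \<inter> (\<Union>b\<in>\<Theta>. tile b)))"

lemma boundary_tile: "boundary D (tile (g, F)) = tile (g, boundary D F)"
  by (auto simp: boundary_def mem_tile diff_conv_add_uminus add.assoc simp del: add_uminus_conv_diff)

lemma folner_card_at_top:
  assumes inf: "infinite (UNIV :: 'g::group_add set)" and F: "folner_sequence (F :: nat \<Rightarrow> 'g set)"
  shows "\<forall>\<^sub>F m in sequentially. card (F m) \<ge> N"
proof -
  obtain A :: "'g set" where A: "finite A" "card A = N"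
    using infinite_arbitrarily_large[OF inf] by blast
  have "\<forall>\<^sub>F m in sequentially. \<forall>g\<in>A. g \<in> F m"
    using F A(1) by (intro eventually_ball_finite) (auto simp: folner_sequence_def)
  then show ?thesis
    using folner_nonempty[OF F]
    by eventually_elim (use A in \<open>auto intro!: card_mono\<close>)
qed

text \<open>
  Late Folner sets are as invariant as desired, and arbitrarily large since the group is infinite.
\<close>

lemma ex_invariant_shape:
  fixes L :: "'g::group_add set" and \<theta> \<kappa> a :: real
  assumes inf: "infinite (UNIV :: 'g set)" and F: "folner_sequence (F :: nat \<Rightarrow> 'g set)"
    and L: "finite L" and th: "\<theta> > 0" and a: "a > 0" and k: "\<kappa> > 0"
  obtains S where "finite S" "S \<noteq> {}" "card (prodset L S) \<le> (1 + \<theta>) * card S"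
    "exp (- a * card S) \<le> \<kappa>"
proof -
  obtain N :: nat where N: "real N \<ge> - ln \<kappa> / a" using real_arch_simple by blast
  have fin: "finite (insert 0 L)" "insert 0 L \<noteq> {}" using L by auto
  have "\<forall>\<^sub>F m in sequentially. finite (F m) \<and> F m \<noteq> {} \<and> card (F m) \<ge> N
      \<and> card (prodset (insert 0 L) (F m)) \<le> (1 + \<theta>) * card (F m)"
    using folner_nonempty[OF F] folner_card_at_top[OF inf F] folner_prodset[OF F fin th]
    by eventually_elim auto
  then obtain m where m: "finite (F m)" "F m \<noteq> {}" "card (F m) \<ge> N"
    "card (prodset (insert 0 L) (F m)) \<le> (1 + \<theta>) * card (F m)"
    using eventually_happens'[OF sequentially_bot] by blast
  show ?thesis
  proof
    show "finite (F m)" "F m \<noteq> {}" using m by auto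
    have "card (prodset L (F m)) \<le> card (prodset (insert 0 L) (F m))"
      using m(1) fin by (intro card_mono finite_prodset) (auto simp: prodset_def)
    then show "card (prodset L (F m)) \<le> (1 + \<theta>) * card (F m)" using m(4) by linarith
    have "- ln \<kappa> / a \<le> card (F m)" using N m(3) by linarith
    then have "- ln \<kappa> \<le> card (F m) * a" by (rule iffD1[OF pos_divide_le_eq[OF a]])
    then have "- a * card (F m) \<le> ln \<kappa>" by (simp add: mult.commute)
    then show "exp (- a * card (F m)) \<le> \<kappa>" using k by (metis exp_le_cancel_iff exp_ln)
  qed
qed

text \<open>
  One round of the construction. The shape \<open>S\<close> is chosen first, so that the earlier tiles, which come from the
  hypothesis on all \<open>L\<close> and \<open>\<kappa>\<close>, can be made invariant under \<open>- S\<close> as well. The greedy family around them then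
  covers about \<open>\<theta> (1 - (1 + \<epsilon>) u)\<close> more, which is at least \<open>\<theta> \<epsilon>\<close> as long as \<open>u \<le> 1 - 2 \<epsilon>\<close>;
  half of this gain is given away to boundary effects.
\<close>

lemma coverage_step:
  fixes F :: "nat \<Rightarrow> 'g::group_add set" and u \<epsilon> \<theta> a :: real
  assumes inf: "infinite (UNIV :: 'g set)" and count: "countable (UNIV :: 'g set)"
    and F: "folner_sequence F"
    and eps: "0 < \<epsilon>" "\<epsilon> \<le> 1" and th: "0 < \<theta>" "\<theta> \<le> \<epsilon> / 4"
    and a: "a > 0" "\<theta> - \<theta> * ln \<theta> \<le> a / 4"
    and u: "u \<le> 1 - 2 * \<epsilon>"
    and IH: "\<And>L \<kappa>. finite L \<Longrightarrow> \<kappa> > 0 \<Longrightarrow> \<exists>\<Theta>. quasitiling L \<epsilon> a \<kappa> \<Theta> \<and> covers F u \<Theta>"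
    and L: "finite L" and k: "\<kappa> > 0"
  shows "\<exists>\<Theta>. quasitiling L \<epsilon> a \<kappa> \<Theta> \<and> covers F (u + \<theta> * \<epsilon> / 2) \<Theta>"
proof -
  obtain S where S: "finite S" "S \<noteq> {}" "card (prodset L S) \<le> (1 + \<theta>) * card S"
    "exp (- (a / 4) * card S) \<le> \<kappa> / 2"
    using ex_invariant_shape[OF inf F L th(1), of "a / 4" "\<kappa> / 2"] a k by auto
  obtain \<Theta>0 where \<Theta>0: "quasitiling (L \<union> uminus ` S) \<epsilon> a (\<kappa> / 2) \<Theta>0" and cov0: "covers F u \<Theta>0"
    using IH[of "L \<union> uminus ` S" "\<kappa> / 2"] L S(1) k by auto
  define \<S> where "\<S> = snd ` \<Theta>0"
  define U where "U = (\<Union>b\<in>\<Theta>0. tile b)"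
  have shapes: "finite \<S>" "\<And>P. P \<in> \<S> \<Longrightarrow> finite P \<and> P \<noteq> {}"
    and inv: "\<And>P. P \<in> \<S> \<Longrightarrow> card (prodset (L \<union> uminus ` S) P) \<le> (1 + \<epsilon>) * card P"
    and disj0: "disjoint_family_on tile \<Theta>0" and press0: "pressure a \<S> \<le> \<kappa> / 2"
    using \<Theta>0 by (auto simp: quasitiling_def \<S>_def)
  have inv': "card (prodset K P) \<le> (1 + \<epsilon>) * card P" if "P \<in> \<S>" "K \<subseteq> L \<union> uminus ` S" for K P
  proof -
    have "card (prodset K P) \<le> card (prodset (L \<union> uminus ` S) P)"
      using that L S(1) shapes(2)[OF that(1)]
      by (intro card_mono finite_prodset) (auto simp: prodset_def)
    then show ?thesis using inv[OF that(1)] by linarith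
  qed
  have th1: "\<theta> \<le> 1 / 2" "\<theta> \<le> 1" using th eps by auto
  obtain \<Theta>1 where shape1: "snd ` \<Theta>1 \<subseteq> almost_full \<theta> S" and disj1: "disjoint_family_on tile \<Theta>1"
    and sep: "U \<inter> (\<Union>b\<in>\<Theta>1. tile b) = {}"
    and dense: "\<And>g. \<theta> * card S \<le> card (tile (g, S) \<inter> (U \<union> (\<Union>b\<in>\<Theta>1. tile b)))"
    by (rule greedy_tiling[OF count S(1) th(1) th1(2), of U]) (rule that)
  define V where "V = (\<Union>b\<in>\<Theta>1. tile b)"
  define \<Theta> where "\<Theta> = \<Theta>0 \<union> \<Theta>1"
  have shp1: "finite P \<and> P \<noteq> {} \<and> card (prodset L P) \<le> (1 + \<epsilon>) * card P" if "P \<in> snd ` \<Theta>1" for P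
  proof -
    have P: "P \<in> almost_full \<theta> S" using that shape1 by blast
    have PS: "P \<subseteq> S" "finite P" using P S(1) by (auto simp: almost_full_def intro: finite_subset)
    have ge: "(1 - \<theta>) * card S \<le> card P" by (rule card_almost_full_member[OF S(1) P])
    have "0 < (1 - \<theta>) * card S" using th1 S by (intro mult_pos_pos) (auto simp: card_gt_0_iff)
    then have "P \<noteq> {}" using ge by auto
    moreover have "card (prodset L P) \<le> card (prodset L S)"
      using PS L S(1) by (intro card_mono finite_prodset) (auto simp: prodset_def)
    moreover have "(1 + \<theta>) * card S \<le> ((1 + \<epsilon>) * (1 - \<theta>)) * card S"
    proof (intro mult_right_mono)
      have "\<epsilon> * \<theta> \<le> 1 * \<theta>" using eps th by (intro mult_right_mono) auto
      moreover have "(1 + \<epsilon>) * (1 - \<theta>) = 1 + \<epsilon> - \<theta> - \<epsilon> * \<theta>" by (simp add: algebra_simps)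
      ultimately show "1 + \<theta> \<le> (1 + \<epsilon>) * (1 - \<theta>)" using th by linarith
    qed simp
    moreover have "(1 + \<epsilon>) * ((1 - \<theta>) * card S) \<le> (1 + \<epsilon>) * card P"
      using ge eps by (intro mult_left_mono) auto
    ultimately show ?thesis using S(3) PS by (simp add: mult.assoc)
  qed
  have "quasitiling L \<epsilon> a \<kappa> \<Theta>"
  proof -
    have fin1: "finite (snd ` \<Theta>1)" using shape1 finite_almost_full[OF S(1)] finite_subset by blast
    have "pressure a (snd ` \<Theta>) \<le> pressure a \<S> + pressure a (snd ` \<Theta>1)"
    proof -
      have "pressure a (snd ` \<Theta>) = pressure a \<S> + pressure a (snd ` \<Theta>1 - \<S>)"
      proof -
        have "snd ` \<Theta> = \<S> \<union> (snd ` \<Theta>1 - \<S>)" by (auto simp: \<Theta>_def \<S>_def image_Un)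
        then show ?thesis
          using shapes(1) fin1 unfolding pressure_def by (simp only:) (rule sum.union_disjoint; blast)
      qed
      also have "pressure a (snd ` \<Theta>1 - \<S>) \<le> pressure a (snd ` \<Theta>1)"
        using fin1 unfolding pressure_def by (intro sum_mono2) auto
      finally show ?thesis by simp
    qed
    also have "pressure a (snd ` \<Theta>1) \<le> pressure a (almost_full \<theta> S)"
      using shape1 finite_almost_full[OF S(1)] unfolding pressure_def by (intro sum_mono2) auto
    also have "\<dots> \<le> \<kappa> / 2"
      using pressure_almost_full_le[OF S(1) th(1) th1(1) a] S(4) by simp
    finally have press: "pressure a (snd ` \<Theta>) \<le> \<kappa>" using press0 by simp
    have disj: "disjoint_family_on tile \<Theta>"
    proof -
      have "tile x \<inter> tile y = {}" if "x \<in> \<Theta>0" "y \<in> \<Theta>1" for x y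
        using sep that by (auto simp: U_def)
      then show ?thesis
        using disj0 disj1 unfolding \<Theta>_def disjoint_family_on_def by (metis Int_commute UnE)
    qed
    have eq: "snd ` \<Theta> = \<S> \<union> snd ` \<Theta>1" by (simp add: \<Theta>_def \<S>_def image_Un)
    have "finite P \<and> P \<noteq> {} \<and> card (prodset L P) \<le> (1 + \<epsilon>) * card P" if "P \<in> snd ` \<Theta>" for P
    proof -
      have "P \<in> \<S> \<union> snd ` \<Theta>1" using that by (simp only: eq)
      then show ?thesis
      proof (rule UnE)
        assume P: "P \<in> \<S>"
        show ?thesis using shapes(2)[OF P] inv'[OF P, of L] by simp
      next
        assume "P \<in> snd ` \<Theta>1"
        then show ?thesis by (rule shp1)
      qed
    qed
    moreover have "finite (snd ` \<Theta>)" unfolding eq using shapes(1) fin1 by (rule finite_UnI)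
    ultimately show ?thesis
      unfolding quasitiling_def using press disj by (intro conjI ballI) simp_all
  qed
  moreover have "covers F (u + \<theta> * \<epsilon> / 2) \<Theta>"
  proof -
    \<comment> \<open>Both boundary terms together cost \<open>\<eta> (1 + |S|) = \<epsilon> / 2\<close>, see \<open>etaw\<close>.\<close>
    define \<eta> where "\<eta> = \<epsilon> / (2 * (1 + card S))"
    have eta: "\<eta> > 0" using eps by (simp add: \<eta>_def)
    have finD: "finite (differences \<S>)" using finite_differences shapes by blast
    show ?thesis
      unfolding covers_def
      using folner_boundary[OF F S(1) eta] folner_boundary[OF F finD eta] folner_nonempty[OF F]
        cov0[unfolded covers_def]
    proof eventually_elim
      case (elim m)
      show ?case
      proof
        fix g
        define W where "W = tile (g, F m)"
        define v where "v = real (card (U \<inter> W))"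
        define w where "w = real (card (F m))"
        have finW: "finite W" and cW: "card W = card (F m)" using elim by (auto simp: W_def)
        have bS: "card (boundary S W) \<le> \<eta> * w" and bD: "card (boundary (differences \<S>) W) \<le> \<eta> * w"
          using elim by (simp_all add: W_def boundary_tile w_def)
        have uv: "u * w \<le> v" using elim(4) by (simp add: v_def w_def W_def U_def Int_commute)
        have new: "\<theta> * card S \<le> card (tile (h, S) \<inter> V)" if "tile (h, S) \<inter> U = {}" for h
        proof -
          have "tile (h, S) \<inter> (U \<union> V) = tile (h, S) \<inter> V" using that by blast
          then show ?thesis using dense[of h] by (simp add: V_def)
        qed
        have blocked: "card {h \<in> W. tile (h, S) \<inter> (U \<inter> W) \<noteq> {}} \<le> (1 + \<epsilon>) * v + card S * (\<eta> * w)"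
        proof -
          have "card {h \<in> W. tile (h, S) \<inter> (U \<inter> W) \<noteq> {}}
              \<le> (1 + \<epsilon>) * v + real (card S) * real (card (boundary (differences \<S>) W))"
            unfolding v_def U_def
            by (rule card_blocked_le[OF finW S(1) shapes _ _ disj0])
              (use inv'[of _ "uminus ` S"] eps in \<open>auto simp: \<S>_def\<close>)
          also have "real (card S) * real (card (boundary (differences \<S>) W)) \<le> card S * (\<eta> * w)"
            using bD by (intro mult_left_mono) auto
          finally show ?thesis by simp
        qed
        have etaw: "\<eta> * w + card S * (\<eta> * w) = \<epsilon> / 2 * w"
          by (simp add: \<eta>_def divide_simps) (simp add: algebra_simps)
        have "\<theta> * (w - \<epsilon> / 2 * w - (1 + \<epsilon>) * v)
            \<le> \<theta> * (real (card W) - card (boundary S W) - card {h \<in> W. tile (h, S) \<inter> (U \<inter> W) \<noteq> {}})"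
        proof (intro mult_left_mono)
          show "w - \<epsilon> / 2 * w - (1 + \<epsilon>) * v
            \<le> real (card W) - card (boundary S W) - card {h \<in> W. tile (h, S) \<inter> (U \<inter> W) \<noteq> {}}"
            using bS blocked etaw cW by (simp add: w_def)
        qed (use th in simp)
        also have "\<dots> \<le> card (V \<inter> W)"
          by (rule card_new_ge[OF finW S(1,2) new th(1)])
        finally have V: "\<theta> * (w - \<epsilon> / 2 * w - (1 + \<epsilon>) * v) \<le> card (V \<inter> W)" .
        have "card (W \<inter> (\<Union>b\<in>\<Theta>. tile b)) = card ((U \<inter> W) \<union> (V \<inter> W))"
          by (rule arg_cong[of _ _ card]) (auto simp: \<Theta>_def U_def V_def)
        also have "\<dots> = card (U \<inter> W) + card (V \<inter> W)"
          using sep finW by (intro card_Un_disjoint) (auto simp: V_def)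
        finally have tot: "card (W \<inter> (\<Union>b\<in>\<Theta>. tile b)) \<ge> v + \<theta> * (w - \<epsilon> / 2 * w - (1 + \<epsilon>) * v)"
          using V by (simp add: v_def)
        have "(u + \<theta> * \<epsilon> / 2) * w \<le> u * w + \<theta> * (w - \<epsilon> / 2 * w - (1 + \<epsilon>) * (u * w))"
        proof -
          have "(1 + \<epsilon>) * u \<le> (1 + \<epsilon>) * (1 - 2 * \<epsilon>)" using u eps by (intro mult_left_mono) auto
          also have "\<dots> \<le> 1 - \<epsilon>" using eps by (simp add: algebra_simps)
          finally have "(\<theta> * w) * ((1 + \<epsilon>) * u) \<le> (\<theta> * w) * (1 - \<epsilon>)"
            using th by (intro mult_left_mono) (auto simp: w_def)
          then show ?thesis by (simp add: algebra_simps)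
        qed
        \<comment> \<open>The old density may exceed \<open>u\<close>; the bound increases with it because \<open>\<theta> (1 + \<epsilon>) \<le> 1\<close>.\<close>
        also have "\<dots> \<le> v + \<theta> * (w - \<epsilon> / 2 * w - (1 + \<epsilon>) * v)"
        proof -
          have "\<theta> * (1 + \<epsilon>) \<le> 1 / 2 * 2" using th1 th eps by (intro mult_mono) auto
          then have "0 \<le> (1 - \<theta> * (1 + \<epsilon>)) * (v - u * w)"
            using uv by (intro mult_nonneg_nonneg) auto
          then show ?thesis by (simp add: algebra_simps)
        qed
        finally show "(u + \<theta> * \<epsilon> / 2) * card (F m) \<le> card (tile (g, F m) \<inter> (\<Union>b\<in>\<Theta>. tile b))"
          using tot by (simp add: W_def w_def)
      qed
    qed
  qed
  ultimately show ?thesis by blast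
qed

text \<open>
  The function \<open>- \<theta> ln \<theta>\<close> tends to 0 with \<open>\<theta>\<close>; the square \<open>\<theta> = r * r\<close> makes this explicit, since \<open>- r ln r \<le> 1\<close>.
\<close>

lemma ex_threshold:
  fixes c :: real
  assumes "c > 0"
  obtains \<theta> :: real where "0 < \<theta>" "\<theta> \<le> c" "\<theta> - \<theta> * ln \<theta> \<le> c"
proof -
  define r where "r = min 1 (c / 3)"
  have r: "0 < r" "r \<le> 1" "3 * r \<le> c" using assms by (auto simp: r_def)
  have "r * (- ln r) \<le> r * (inverse r - 1)"
    using ln_le_minus_one[of "inverse r"] r by (intro mult_left_mono) (auto simp: ln_inverse)
  also have "\<dots> \<le> 1" using r by (simp add: algebra_simps)
  finally have "r * (r * (- ln r)) \<le> r * 1" using r by (intro mult_left_mono) auto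
  then have "- (r * r * ln r) \<le> r" by (simp add: mult.assoc)
  moreover have le: "r * r \<le> r * 1" using r by (intro mult_left_mono) auto
  moreover have "ln (r * r) = 2 * ln r" using r by (simp add: ln_mult)
  ultimately have "r * r - r * r * ln (r * r) \<le> c" using r(3) by (simp add: algebra_simps)
  moreover have "r * r \<le> c" using le r by linarith
  moreover have "0 < r * r" using r by simp
  ultimately show ?thesis by (intro that[of "r * r"])
qed

text \<open>
  Rounds are added until the density exceeds \<open>1 - 2 \<epsilon>\<close>. The induction is on statements about all finite \<open>L\<close> and
  all \<open>\<kappa> > 0\<close>, as each round needs more invariant tiles of smaller pressure from the rounds before.
\<close>

theorem ex_quasitiling:
  fixes F :: "nat \<Rightarrow> 'g::group_add set" and \<epsilon> a :: real
  assumes inf: "infinite (UNIV :: 'g set)" and count: "countable (UNIV :: 'g set)"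
    and F: "folner_sequence F" and L: "finite L"
    and eps: "0 < \<epsilon>" "\<epsilon> \<le> 1" and a: "a > 0"
  obtains \<Theta> where "quasitiling L \<epsilon> a a \<Theta>" "covers F (1 - 2 * \<epsilon>) \<Theta>"
proof -
  have "0 < min (\<epsilon> / 4) (a / 4)" using eps a by simp
  then obtain \<theta> :: real where "0 < \<theta>" "\<theta> \<le> min (\<epsilon> / 4) (a / 4)"
      "\<theta> - \<theta> * ln \<theta> \<le> min (\<epsilon> / 4) (a / 4)"
    by (rule ex_threshold)
  then have th: "0 < \<theta>" "\<theta> \<le> \<epsilon> / 4" "\<theta> - \<theta> * ln \<theta> \<le> a / 4" by auto
  define good where
    "good u \<longleftrightarrow> (\<forall>L \<kappa>. finite L \<longrightarrow> \<kappa> > 0 \<longrightarrow> (\<exists>\<Theta>. quasitiling L \<epsilon> a \<kappa> \<Theta> \<and> covers F u \<Theta>))" for u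
  have "\<exists>u. min (n * (\<theta> * \<epsilon> / 2)) (1 - 2 * \<epsilon>) \<le> u \<and> good u" for n :: nat
  proof (induction n)
    case 0
    have "quasitiling L \<epsilon> a \<kappa> {}" if "\<kappa> > 0" for L \<kappa>
      using that by (simp add: quasitiling_def pressure_def disjoint_family_on_def)
    moreover have "covers F 0 {}" by (simp add: covers_def)
    ultimately have "good 0" by (auto simp: good_def)
    then show ?case by (intro exI[of _ 0]) auto
  next
    case (Suc n)
    then obtain u where u: "min (n * (\<theta> * \<epsilon> / 2)) (1 - 2 * \<epsilon>) \<le> u" "good u" by blast
    show ?case
    proof (cases "u \<le> 1 - 2 * \<epsilon>")
      case True
      have "good (u + \<theta> * \<epsilon> / 2)"
        unfolding good_def using u(2)
        by (intro allI impI coverage_step[OF inf count F eps th(1,2) a th(3) True])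
          (auto simp: good_def)
      moreover have "min (Suc n * (\<theta> * \<epsilon> / 2)) (1 - 2 * \<epsilon>) \<le> u + \<theta> * \<epsilon> / 2"
      proof -
        have "Suc n * (\<theta> * \<epsilon> / 2) = n * (\<theta> * \<epsilon> / 2) + \<theta> * \<epsilon> / 2" by (simp add: algebra_simps)
        moreover have "\<theta> * \<epsilon> / 2 > 0" using th eps by simp
        ultimately show ?thesis using u(1) by (auto simp: min_def split: if_splits)
      qed
      ultimately show ?thesis by blast
    next
      case False
      then show ?thesis using u(2) by (intro exI[of _ u]) auto
    qed
  qed
  note ex = this
  obtain n :: nat where "1 / (\<theta> * \<epsilon> / 2) \<le> n" using real_arch_simple by blast
  moreover have "\<theta> * \<epsilon> / 2 > 0" using th eps by simp
  ultimately have "1 \<le> n * (\<theta> * \<epsilon> / 2)" by (simp only: pos_divide_le_eq)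
  then have "min (n * (\<theta> * \<epsilon> / 2)) (1 - 2 * \<epsilon>) = 1 - 2 * \<epsilon>" using eps by (intro min_absorb2) linarith
  then obtain u where u: "1 - 2 * \<epsilon> \<le> u" "good u" using ex[of n] by auto
  obtain \<Theta> where "quasitiling L \<epsilon> a a \<Theta>" and cov: "covers F u \<Theta>"
    using u(2) L a unfolding good_def by blast
  moreover have "covers F (1 - 2 * \<epsilon>) \<Theta>"
    using cov unfolding covers_def
  proof eventually_elim
    case (elim m)
    have "(1 - 2 * \<epsilon>) * card (F m) \<le> u * card (F m)" using u(1) by (intro mult_right_mono) auto
    then show ?case using elim by (meson order_trans)
  qed
  ultimately show ?thesis using that by blast
qed

section \<open>Exchanging patterns on tiles\<close>

lemma mem_tile_diff: "h \<in> tile (c - g, P) \<longleftrightarrow> h + g \<in> tile (c, P)"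
  by (simp add: mem_tile diff_conv_add_uminus minus_add add.assoc del: add_uminus_conv_diff)

text \<open>
  The situation in which the chain is built. One number \<open>a\<close> serves both as the parameter and as
  the bound of the pressure, so that packings of \<open>F\<close> number at most \<open>exp (2 a |F|)\<close>.
\<close>

locale tiled_sft =
  fixes X :: "('g::group_add \<Rightarrow> 'a::finite) set" and K :: "'g set"
    and \<Theta> :: "('g \<times> 'g set) set" and a :: real
  assumes finite_window: "finite K"
    and window: "\<And>x. (\<And>g. \<exists>y\<in>X. \<forall>k\<in>K. x (k + g) = y (k + g)) \<Longrightarrow> x \<in> X"
    and shift_closed: "\<And>x g. x \<in> X \<Longrightarrow> shift g x \<in> X"
    and finite_shapes: "finite (snd ` \<Theta>)"
    and shapes: "\<And>P. P \<in> snd ` \<Theta> \<Longrightarrow> finite P \<and> P \<noteq> {}"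
    and disjoint_tiles: "disjoint_family_on tile \<Theta>"
    and a_pos: "a > 0"
    and pressure_le: "pressure a (snd ` \<Theta>) \<le> a"
begin

abbreviation "\<S> \<equiv> snd ` \<Theta>"

abbreviation "D \<equiv> differences \<S>"

text \<open>
  A translate of \<open>K\<close> through \<open>h\<close> is contained in \<open>reach + h\<close>. So a translate of \<open>K\<close> that meets a tile off
  its boundary with respect to \<open>reach\<close> lies inside the tile.
\<close>

definition reach :: "'g set" where
  "reach = insert 0 (differences {K})"

lemma zero_in_reach: "0 \<in> reach"
  by (simp add: reach_def)

lemma finite_reach: "finite reach"
  unfolding reach_def using finite_window by (intro finite.insertI finite_differences) auto

definition tile_patterns :: "('g \<rightharpoonup> 'a) set" where
  "tile_patterns = (\<Union>P\<in>\<S>. patterns P X)"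

text \<open>
  The shape of a pattern and its values near the boundary of the shape. Two patterns of \<open>X\<close> with the same frame can
  be exchanged for each other on a tile.
\<close>

definition frame :: "('g \<rightharpoonup> 'a) \<Rightarrow> 'g set \<times> ('g \<rightharpoonup> 'a)" where
  "frame p = (dom p, p |` boundary reach (dom p))"

definition rep :: "('g \<rightharpoonup> 'a) \<Rightarrow> ('g \<rightharpoonup> 'a)" where
  "rep p = (SOME q. q \<in> tile_patterns \<and> frame q = frame p)"

definition redundant :: "('g \<rightharpoonup> 'a) set" where
  "redundant = {p \<in> tile_patterns. rep p \<noteq> p}"

definition avoiding :: "('g \<rightharpoonup> 'a) set \<Rightarrow> ('g \<Rightarrow> 'a) set" where
  "avoiding Q = {x \<in> X. \<forall>(c, P)\<in>\<Theta>. restriction (shift c x) P \<notin> Q}"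

lemma avoiding_subset: "avoiding Q \<subseteq> X"
  by (auto simp: avoiding_def)

lemma avoiding_empty: "avoiding {} = X"
  by (auto simp: avoiding_def)

lemma finite_redundant: "finite redundant"
proof -
  have "finite tile_patterns"
    unfolding tile_patterns_def using finite_shapes shapes by (intro finite_UN_I finite_patterns) auto
  then show ?thesis by (simp add: redundant_def)
qed

lemma tile_patterns_witness:
  assumes "p \<in> tile_patterns"
  obtains z where "z \<in> X" "p = restriction z (dom p)"
proof -
  obtain P g x where "x \<in> X" "p = restriction (shift g x) P"
    using assms unfolding tile_patterns_def patterns_def by blast
  then show ?thesis using that[of "shift g x"] shift_closed by simp
qed

lemma content_in_tile_patterns:
  "(c, P) \<in> \<Theta> \<Longrightarrow> x \<in> X \<Longrightarrow> restriction (shift c x) P \<in> tile_patterns"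
  unfolding tile_patterns_def patterns_def by force

lemma rep:
  assumes "p \<in> tile_patterns"
  shows "rep p \<in> tile_patterns" "frame (rep p) = frame p"
  using someI[of "\<lambda>q. q \<in> tile_patterns \<and> frame q = frame p" p] assms by (auto simp: rep_def)

lemma rep_eq: "frame p = frame q \<Longrightarrow> rep p = rep q"
  by (simp add: rep_def)

lemma rep_not_redundant: "p \<in> tile_patterns \<Longrightarrow> rep p \<notin> redundant"
  using rep(2)[of p] rep_eq[of "rep p" p] by (simp add: redundant_def)

lemma irredundant_eq:
  assumes "p \<in> tile_patterns - redundant" "q \<in> tile_patterns - redundant" "frame p = frame q"
  shows "p = q"
  using assms rep_eq[OF assms(3)] by (auto simp: redundant_def)

lemma tile_unique:
  assumes "(c, P) \<in> \<Theta>" "(c', P') \<in> \<Theta>" "h \<in> tile (c, P)" "h \<in> tile (c', P')"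
  shows "c = c' \<and> P = P'"
  using disjoint_tiles assms unfolding disjoint_family_on_def by (metis IntI emptyE prod.inject)

text \<open>
  On all tiles of \<open>x\<close> that carry the redundant pattern \<open>p\<close>, put its representative. A translate of the window
  that meets the interior of such a tile lies in this tile and shows a part of a pattern of \<open>X\<close>. Every other translate
  sees no change, since the two patterns agree near the boundary. The tiles are disjoint, so the remaining tiles keep their
  patterns; and representatives are not redundant, so they are never forbidden.
\<close>

lemma replace_in_tiles:
  assumes x: "x \<in> avoiding Q" and Q: "Q \<subseteq> redundant" and p: "p \<in> redundant"
  defines "C \<equiv> {c. (c, dom p) \<in> \<Theta> \<and> restriction (shift c x) (dom p) = p}"
  obtains y where "y \<in> avoiding (insert p Q)"
    "\<And>h. (\<And>c. c \<in> C \<Longrightarrow> h \<notin> tile (c, dom p)) \<Longrightarrow> y h = x h"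
proof -
  let ?P = "dom p"
  have pt: "p \<in> tile_patterns" using p by (simp add: redundant_def)
  define q where "q = rep p"
  have q: "q \<in> tile_patterns" "frame q = frame p" "q \<notin> redundant"
    using rep[OF pt] rep_not_redundant[OF pt] by (simp_all add: q_def)
  have dq: "dom q = ?P" using q(2) by (simp add: frame_def)
  have qb: "q i = p i" if "i \<in> boundary reach ?P" for i
  proof -
    have "q |` boundary reach ?P = p |` boundary reach ?P"
      using q(2) dq by (simp add: frame_def)
    from fun_cong[OF this, of i] show ?thesis using that by simp
  qed
  obtain z where z: "z \<in> X" "q = restriction z ?P"
    using tile_patterns_witness[OF q(1)] dq by metis
  define y where
    "y h = (if \<exists>c\<in>C. h \<in> tile (c, ?P) then z (h - (THE c. c \<in> C \<and> h \<in> tile (c, ?P))) else x h)" for h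
  have y_in: "y h = z (h - c)" if "c \<in> C" "h \<in> tile (c, ?P)" for c h
  proof -
    have "(THE c. c \<in> C \<and> h \<in> tile (c, ?P)) = c"
      using that tile_unique by (intro the_equality) (auto simp: C_def)
    then show ?thesis using that by (auto simp: y_def)
  qed
  have y_out: "y h = x h" if "\<And>c. c \<in> C \<Longrightarrow> h \<notin> tile (c, ?P)" for h
    using that by (auto simp: y_def)
  have xX: "x \<in> X" using x avoiding_subset by blast
  have "y \<in> X"
  proof (rule window)
    fix g
    show "\<exists>w\<in>X. \<forall>k\<in>K. y (k + g) = w (k + g)"
    proof (cases "\<exists>c\<in>C. \<exists>k\<in>K. k + g \<in> tile (c, ?P - boundary reach ?P)")
      case True
      then obtain c k where c: "c \<in> C" and k: "k \<in> K" and kg: "k + g \<in> tile (c, ?P - boundary reach ?P)"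
        by blast
      have inP: "k' + g \<in> tile (c, ?P)" if k': "k' \<in> K" for k'
      proof -
        have "k' - k \<in> reach" using k k' by (auto simp: reach_def differences_def)
        moreover have "k + g - c \<in> ?P" "k + g - c \<notin> boundary reach ?P" using kg by (auto simp: mem_tile)
        ultimately have "(k' - k) + (k + g - c) \<in> ?P" unfolding boundary_def by blast
        moreover have "(k' - k) + (k + g - c) = k' + g - c"
          by (simp add: diff_conv_add_uminus add.assoc del: add_uminus_conv_diff)
        ultimately show ?thesis by (simp add: mem_tile)
      qed
      show ?thesis
        using shift_closed[OF z(1), of "- c"] inP y_in[OF c]
        by (intro bexI[of _ "shift (- c) z"]) (auto simp: shift_def)
    next
      case False
      have "y (k + g) = x (k + g)" if k: "k \<in> K" for k
      proof (cases "\<exists>c\<in>C. k + g \<in> tile (c, ?P)")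
        case True
        then obtain c where c: "c \<in> C" "k + g \<in> tile (c, ?P)" by blast
        define i where "i = k + g - c"
        have i: "i \<in> boundary reach ?P" and kg: "k + g = i + c"
          using False k c by (auto simp: mem_tile i_def)
        have iP: "i \<in> ?P" using i boundary_subset by blast
        have "restriction (shift c x) ?P i = p i" using c(1) by (simp add: C_def)
        then have "Some (x (i + c)) = q i" using qb[OF i] iP by (simp add: restriction_def shift_def)
        also have "\<dots> = Some (z i)" using iP by (subst z(2)) (simp add: restriction_def)
        finally show ?thesis using y_in[OF c] by (simp add: kg)
      qed (use y_out in blast)
      then show ?thesis using xX by blast
    qed
  qed
  moreover have "restriction (shift c y) P \<notin> insert p Q" if b: "(c, P) \<in> \<Theta>" for c P
  proof (cases "P = ?P \<and> c \<in> C")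
    case True
    then have "restriction (shift c y) P = q"
      using y_in[of c] by (subst z(2)) (auto simp: restriction_def shift_def fun_eq_iff)
    then show ?thesis using q(3) Q p by auto
  next
    case False
    have "y (i + c) = x (i + c)" if i: "i \<in> P" for i
    proof (rule y_out)
      fix c' assume c': "c' \<in> C"
      show "i + c \<notin> tile (c', ?P)"
        using tile_unique[OF b, of c' ?P "i + c"] c' False i by (auto simp: C_def)
    qed
    then have eq: "restriction (shift c y) P = restriction (shift c x) P"
      by (auto simp: restriction_def shift_def fun_eq_iff)
    have "restriction (shift c x) P \<noteq> p"
    proof
      assume "restriction (shift c x) P = p"
      moreover from this have "dom p = P" by (metis dom_restriction)
      ultimately show False using False b by (simp add: C_def)
    qed
    then show ?thesis using x b unfolding eq by (auto simp: avoiding_def)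
  qed
  ultimately have "y \<in> avoiding (insert p Q)" unfolding avoiding_def by blast
  then show ?thesis using y_out that by blast
qed

lemma no_empty_shape: "{} \<notin> \<S>"
  using shapes by blast

lemma card_packings_shapes:
  assumes "finite F"
  shows "card (packings \<S> F) \<le> exp (2 * a * card F)"
proof -
  have "card (packings \<S> F) \<le> exp ((a + pressure a \<S>) * card F)"
    using card_packings_le[OF assms finite_shapes no_empty_shape] a_pos by simp
  also have "(a + pressure a \<S>) * card F \<le> (2 * a) * card F"
    using pressure_le by (intro mult_right_mono) auto
  finally show ?thesis by simp
qed

section \<open>Counting patterns along the chain\<close>

text \<open>
  What a point shows on \<open>F + g\<close> is recorded as a pattern on \<open>F\<close>, and the tiles there are recorded accordingly.
\<close>

definition inner_tiles :: "'g \<Rightarrow> 'g set \<Rightarrow> ('g \<times> 'g set) set" where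
  "inner_tiles g F = {(c - g, P) |c P. (c, P) \<in> \<Theta> \<and> tile (c - g, P) \<subseteq> F}"

lemma inner_tiles_packing:
  assumes B: "B \<subseteq> inner_tiles g F"
  shows "B \<in> packings \<S> F"
proof -
  have mem: "\<exists>c. (c, snd b) \<in> \<Theta> \<and> b = (c - g, snd b) \<and> tile b \<subseteq> F" if "b \<in> B" for b
  proof -
    from B that obtain c P where "b = (c - g, P)" "(c, P) \<in> \<Theta>" "tile (c - g, P) \<subseteq> F"
      unfolding inner_tiles_def by blast
    then show ?thesis by auto
  qed
  have "tile b \<inter> tile b' = {}" if bB: "b \<in> B" "b' \<in> B" "b \<noteq> b'" for b b'
  proof -
    obtain c P c' P' where b: "b = (c - g, P)" "(c, P) \<in> \<Theta>" "b' = (c' - g, P')" "(c', P') \<in> \<Theta>"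
      using mem[OF bB(1)] mem[OF bB(2)] by blast
    show ?thesis
    proof (rule equals0I)
      fix h assume "h \<in> tile b \<inter> tile b'"
      then have "h + g \<in> tile (c, P)" "h + g \<in> tile (c', P')" by (auto simp: b mem_tile_diff)
      then show False using tile_unique[OF b(2,4)] b bB(3) by auto
    qed
  qed
  moreover have "snd b \<in> \<S>" "tile b \<subseteq> F" if "b \<in> B" for b
    using mem[OF that] by (metis imageI snd_conv)+
  ultimately show ?thesis by (auto simp: packings_def disjoint_family_on_def)
qed

text \<open>
  A pattern on \<open>F\<close> of a point \<open>x\<close> is recovered from the pattern of the modified point \<open>y\<close>, from the positions of the
  modified tiles inside \<open>F\<close>, and from the values of \<open>x\<close> near the boundary of \<open>F\<close>, where modified
  tiles may stick out of \<open>F\<close>.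
\<close>

lemma card_patterns_avoiding_step:
  assumes Q: "Q \<subseteq> redundant" and p: "p \<in> redundant" and F: "finite F"
  shows "card (patterns F (avoiding Q)) \<le> card (patterns F (avoiding (insert p Q)))
    * (exp (2 * a * card F) * real CARD('a) ^ card (boundary D F))"
proof -
  let ?bd = "boundary D F"
  let ?R = "range (\<lambda>x :: 'g \<Rightarrow> 'a. restriction x ?bd)"
  have finbd: "finite ?bd" using F boundary_subset finite_subset by metis
  define decode :: "('g \<rightharpoonup> 'a) \<times> ('g \<times> 'g set) set \<times> ('g \<rightharpoonup> 'a) \<Rightarrow> ('g \<rightharpoonup> 'a)" where
    "decode = (\<lambda>(v, B, w) h. if h \<in> ?bd then w h
      else if \<exists>b\<in>B. h \<in> tile b then p (h - fst (SOME b. b \<in> B \<and> h \<in> tile b)) else v h)"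
  have "patterns F (avoiding Q) \<subseteq> decode ` (patterns F (avoiding (insert p Q)) \<times> packings \<S> F \<times> ?R)"
  proof
    fix v assume "v \<in> patterns F (avoiding Q)"
    then obtain g x where x: "x \<in> avoiding Q" and v: "v = restriction (shift g x) F"
      by (auto simp: patterns_def)
    define C where "C = {c. (c, dom p) \<in> \<Theta> \<and> restriction (shift c x) (dom p) = p}"
    obtain y where y: "y \<in> avoiding (insert p Q)"
      "\<And>h. (\<And>c. c \<in> C \<Longrightarrow> h \<notin> tile (c, dom p)) \<Longrightarrow> y h = x h"
      using replace_in_tiles[OF x Q p] unfolding C_def by blast
    define B where "B = {(c - g, dom p) |c. c \<in> C \<and> tile (c - g, dom p) \<subseteq> F}"
    have "B \<subseteq> inner_tiles g F" unfolding B_def C_def inner_tiles_def by blast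
    then have B: "B \<in> packings \<S> F" by (rule inner_tiles_packing)
    have vd: "v = decode (restriction (shift g y) F, B, restriction (shift g x) ?bd)"
    proof
      fix h
      consider "h \<notin> F" | "h \<in> ?bd" | "h \<in> F" "h \<notin> ?bd" "\<exists>b\<in>B. h \<in> tile b"
        | "h \<in> F" "h \<notin> ?bd" "\<not> (\<exists>b\<in>B. h \<in> tile b)" by blast
      then show "v h = decode (restriction (shift g y) F, B, restriction (shift g x) ?bd) h"
      proof cases
        case 1
        then have "h \<notin> ?bd" "\<not> (\<exists>b\<in>B. h \<in> tile b)"
          using boundary_subset B by (auto simp: packings_def)
        then show ?thesis using 1 by (simp add: v decode_def restriction_def)
      next
        case 2
        then have "h \<in> F" using boundary_subset by blast
        then show ?thesis using 2 by (simp add: v decode_def restriction_def)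
      next
        case 3
        define b where "b = (SOME b. b \<in> B \<and> h \<in> tile b)"
        have b: "b \<in> B" "h \<in> tile b" using someI_ex[of "\<lambda>b. b \<in> B \<and> h \<in> tile b"] 3(3) by (auto simp: b_def)
        then obtain c where c: "b = (c - g, dom p)" "c \<in> C" by (auto simp: B_def)
        define i where "i = h - (c - g)"
        have i: "i \<in> dom p" using b(2) c(1) by (simp add: mem_tile i_def)
        have hg: "h + g = i + c"
          by (simp add: i_def diff_conv_add_uminus minus_add add.assoc del: add_uminus_conv_diff)
        have "restriction (shift c x) (dom p) i = p i" using c(2) by (simp add: C_def)
        then have "v h = p i" using 3(1) i by (simp add: v restriction_def shift_def hg)
        moreover have "fst b = c - g" by (simp add: c)
        ultimately show ?thesis using 3 by (simp add: decode_def b_def[symmetric] i_def)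
      next
        case 4
        have "y (h + g) = x (h + g)"
        proof (rule y(2))
          fix c assume c: "c \<in> C"
          show "h + g \<notin> tile (c, dom p)"
          proof
            assume h: "h + g \<in> tile (c, dom p)"
            then have h': "h \<in> tile (c - g, dom p)" by (simp add: mem_tile_diff)
            have cp: "(c, dom p) \<in> \<Theta>" using c by (simp add: C_def)
            then have "dom p \<in> \<S>" by (metis imageI snd_conv)
            then have "tile (c - g, dom p) \<subseteq> F" by (rule tile_subset_or_boundary[OF _ h' 4(1,2)])
            then have "(c - g, dom p) \<in> B" using c unfolding B_def by blast
            then show False using 4(3) h' by blast
          qed
        qed
        then show ?thesis using 4 by (simp add: decode_def v restriction_def shift_def)
      qed
    qed
    have "restriction (shift g y) F \<in> patterns F (avoiding (insert p Q))"
      unfolding patterns_def using y(1) by blast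
    then show "v \<in> decode ` (patterns F (avoiding (insert p Q)) \<times> packings \<S> F \<times> ?R)"
      unfolding vd by (intro imageI SigmaI B rangeI)
  qed
  moreover have fin: "finite (patterns F (avoiding (insert p Q)) \<times> packings \<S> F \<times> ?R)"
    using finite_patterns[OF F] finite_packings[OF F finite_shapes no_empty_shape] a_pos
      finite_restrictions(1)[OF finbd] by (intro finite_cartesian_product) auto
  ultimately have "card (patterns F (avoiding Q))
      \<le> card (patterns F (avoiding (insert p Q)) \<times> packings \<S> F \<times> ?R)"
    using surj_card_le by blast
  also have "\<dots> = card (patterns F (avoiding (insert p Q))) * (card (packings \<S> F) * card ?R)"
    by (simp add: card_cartesian_product)
  finally have "real (card (patterns F (avoiding Q)))
      \<le> real (card (patterns F (avoiding (insert p Q)))) * (real (card (packings \<S> F)) * real (card ?R))"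
    by (simp flip: of_nat_mult)
  also have "\<dots> \<le> card (patterns F (avoiding (insert p Q)))
      * (exp (2 * a * card F) * real CARD('a) ^ card ?bd)"
  proof (intro mult_left_mono mult_mono card_packings_shapes[OF F])
    show "real (card ?R) \<le> real CARD('a) ^ card ?bd"
      using finite_restrictions(2)[OF finbd, where 'a = 'a] by (simp flip: of_nat_power)
  qed auto
  finally show ?thesis .
qed

text \<open>
  The points of \<open>F\<close> whose values are not forced by the values near the boundaries of the tiles in \<open>B\<close>.
\<close>

definition exposed :: "'g set \<Rightarrow> ('g \<times> 'g set) set \<Rightarrow> 'g set" where
  "exposed F B = {h \<in> F. \<forall>(c, P)\<in>B. h \<notin> tile (c, P - boundary reach P)}"

text \<open>
  A point is exposed for one of three reasons: no tile covers it, its tile sticks out of \<open>F\<close>, or it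
  lies near the boundary of its tile.
\<close>

lemma card_exposed_le:
  fixes u \<beta> :: real
  assumes F: "finite F" and dense: "u * card F \<le> card (tile (g, F) \<inter> (\<Union>b\<in>\<Theta>. tile b))"
    and collar: "\<And>P. P \<in> \<S> \<Longrightarrow> card (boundary reach P) \<le> \<beta> * card P" and "\<beta> \<ge> 0"
  defines "B \<equiv> inner_tiles g F"
  shows "card (exposed F B) \<le> (1 - u + \<beta>) * card F + card (boundary D F)"
proof -
  let ?U = "\<Union>b\<in>\<Theta>. tile b"
  define N where "N = {h \<in> F. h + g \<notin> ?U}"
  let ?col = "\<lambda>b. tile (fst b, boundary reach (snd b))"
  have B: "B \<in> packings \<S> F" unfolding B_def by (rule inner_tiles_packing[OF subset_refl])
  have finB: "finite B"
    using packing_finite[OF F finite_shapes no_empty_shape _ B, of a] a_pos by simp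
  have finbd: "finite (boundary D F)" using F boundary_subset finite_subset by metis
  have shapeB: "snd b \<in> \<S>" if "b \<in> B" for b using that B by (auto simp: packings_def)
  have fincol: "finite (?col b)" if "b \<in> B" for b
    using shapes[OF shapeB[OF that]] boundary_subset finite_subset by (metis finite_tile snd_conv)
  have "exposed F B \<subseteq> N \<union> boundary D F \<union> (\<Union>b\<in>B. ?col b)"
  proof
    fix h assume h: "h \<in> exposed F B"
    then have hF: "h \<in> F" by (simp add: exposed_def)
    show "h \<in> N \<union> boundary D F \<union> (\<Union>b\<in>B. ?col b)"
    proof (cases "h \<in> N \<or> h \<in> boundary D F")
      case False
      then obtain c P where cP: "(c, P) \<in> \<Theta>" "h + g \<in> tile (c, P)" using hF by (auto simp: N_def)
      then have ht: "h \<in> tile (c - g, P)"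
        by (simp add: mem_tile_diff)
      have "P \<in> \<S>" using cP(1) by force
      then have "tile (c - g, P) \<subseteq> F" using tile_subset_or_boundary[OF _ ht hF] False by blast
      then have b: "(c - g, P) \<in> B" using cP(1) unfolding B_def inner_tiles_def by blast
      then have "h \<notin> tile (c - g, P - boundary reach P)" using h by (auto simp: exposed_def)
      then have "h \<in> ?col (c - g, P)" using ht by (simp add: mem_tile)
      then show ?thesis using b by blast
    qed blast
  qed
  then have "card (exposed F B) \<le> card (N \<union> boundary D F \<union> (\<Union>b\<in>B. ?col b))"
    using finB fincol finbd F by (intro card_mono) (auto simp: N_def simp del: finite_tile)
  also have "\<dots> \<le> card N + card (boundary D F) + card (\<Union>b\<in>B. ?col b)"
    by (meson add_mono card_Un_le le_refl le_trans)
  also have "\<dots> \<le> card N + card (boundary D F) + (\<Sum>b\<in>B. card (?col b))"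
    using card_UN_le[OF finB, of ?col] by (simp del: card_tile)
  finally have "real (card (exposed F B)) \<le> real (card N) + card (boundary D F)
      + (\<Sum>b\<in>B. real (card (boundary reach (snd b))))"
    by (simp flip: of_nat_sum of_nat_add)
  also have "(\<Sum>b\<in>B. real (card (boundary reach (snd b)))) \<le> (\<Sum>b\<in>B. \<beta> * card (tile b))"
    using collar[OF shapeB] by (intro sum_mono) simp
  also have "\<dots> = \<beta> * card (\<Union>b\<in>B. tile b)"
  proof -
    have "card (\<Union>b\<in>B. tile b) = (\<Sum>b\<in>B. card (tile b))"
      using finB B shapes[OF shapeB]
      by (intro card_UN_disjoint) (auto simp: packings_def disjoint_family_on_def)
    then show ?thesis by (simp add: sum_distrib_left)
  qed
  also have "\<dots> \<le> \<beta> * card F"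
    using F B \<open>\<beta> \<ge> 0\<close> by (intro mult_left_mono of_nat_mono card_mono) (auto simp: packings_def)
  also have "real (card N) \<le> (1 - u) * card F"
  proof -
    have "tile (g, F) \<inter> ?U = tile (g, F - N)"
      unfolding set_eq_iff Int_iff Diff_iff mem_tile N_def mem_Collect_eq
      by (simp only: diff_add_cancel) blast
    then have "card (tile (g, F) \<inter> ?U) = card (F - N)" by simp
    also have "\<dots> = card F - card N" using F by (intro card_Diff_subset) (auto simp: N_def)
    finally have "real (card (tile (g, F) \<inter> ?U)) = real (card F) - card N"
      using F by (simp add: N_def card_mono of_nat_diff)
    then show ?thesis using dense by (simp add: algebra_simps)
  qed
  finally show ?thesis by (simp add: algebra_simps)
qed

text \<open>
  Once the tiles inside \<open>F\<close> are known, a pattern is determined by its values on the exposed points: they contain the frame of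
  each tile, and only one irredundant pattern has a given frame.
\<close>

lemma card_patterns_irredundant:
  assumes F: "finite F" and N: "\<And>g. card (exposed F (inner_tiles g F)) \<le> N"
  shows "card (patterns F (avoiding redundant)) \<le> exp (2 * a * card F) * real CARD('a) ^ N"
proof -
  define content where "content v b = (\<lambda>i. if i \<in> snd b then v (i + fst b) else None)"
    for v :: "'g \<rightharpoonup> 'a" and b :: "'g \<times> 'g set"
  define \<B> where "\<B> = {B \<in> packings \<S> F. card (exposed F B) \<le> N}"
  define V where "V B = {v \<in> range (\<lambda>x :: 'g \<Rightarrow> 'a. restriction x F).
    \<forall>b\<in>B. content v b \<in> tile_patterns - redundant}" for B
  have finB: "finite \<B>" using finite_packings[OF F finite_shapes no_empty_shape] a_pos
    unfolding \<B>_def by (intro finite_subset[OF Collect_restrict]) auto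
  have sub: "patterns F (avoiding redundant) \<subseteq> (\<Union>B\<in>\<B>. V B)"
  proof
    fix v assume "v \<in> patterns F (avoiding redundant)"
    then obtain g x where x: "x \<in> avoiding redundant" and v: "v = restriction (shift g x) F"
      by (auto simp: patterns_def)
    define B where "B = inner_tiles g F"
    have "B \<in> \<B>" unfolding \<B>_def B_def using N inner_tiles_packing[OF subset_refl] by simp
    moreover have "content v b \<in> tile_patterns - redundant" if b: "b \<in> B" for b
    proof -
      obtain c P where cP: "b = (c - g, P)" "(c, P) \<in> \<Theta>" "tile (c - g, P) \<subseteq> F"
        using b unfolding B_def inner_tiles_def by blast
      have "content v b = restriction (shift c x) P"
      proof
        fix i
        have "i + (c - g) \<in> F" if "i \<in> P" using cP(3) that by (auto simp: tile_def)
        then show "content v b i = restriction (shift c x) P i"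
          by (auto simp: content_def cP(1) v restriction_def shift_def add.assoc)
      qed
      moreover have "restriction (shift c x) P \<notin> redundant" using x cP(2) by (auto simp: avoiding_def)
      ultimately show ?thesis
        using content_in_tile_patterns[OF cP(2)] x avoiding_subset by auto
    qed
    then have "v \<in> V B" unfolding V_def mem_Collect_eq v by (intro conjI rangeI ballI)
    ultimately show "v \<in> (\<Union>B\<in>\<B>. V B)" by (rule UN_I)
  qed
  have finV: "finite (V B)" for B
    unfolding V_def by (rule finite_subset[OF _ finite_restrictions(1)[OF F, where 'a = 'a]]) auto
  have cV: "card (V B) \<le> CARD('a) ^ N" if B: "B \<in> \<B>" for B
  proof -
    have pack: "B \<in> packings \<S> F" using B by (simp add: \<B>_def)
    define E where "E = exposed F B"
    have EF: "E \<subseteq> F" by (auto simp: E_def exposed_def)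
    have finE: "finite E" using EF F by (rule finite_subset)
    have "inj_on (\<lambda>v. v |` E) (V B)"
    proof (rule inj_onI, rule ext)
      fix v w h assume v: "v \<in> V B" and w: "w \<in> V B" and eq: "v |` E = w |` E"
      have eqE: "v i = w i" if "i \<in> E" for i using fun_cong[OF eq, of i] that by simp
      have dom: "dom u = F" if "u \<in> V B" for u
      proof -
        obtain x where "u = restriction x F" using \<open>u \<in> V B\<close> unfolding V_def by blast
        then show ?thesis by simp
      qed
      consider "h \<notin> F" | "h \<in> E" | "h \<in> F" "h \<notin> E" by blast
      then show "v h = w h"
      proof cases
        case 1 then show ?thesis using dom[OF v] dom[OF w] by (metis domIff)
      next
        case 2 then show ?thesis by (rule eqE)
      next
        case 3
        then obtain c P where b: "(c, P) \<in> B" "h \<in> tile (c, P - boundary reach P)"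
          by (auto simp: E_def exposed_def)
        have PF: "tile (c, P) \<subseteq> F" using pack b(1) by (auto simp: packings_def)
        have doms: "dom (content u (c, P)) = P" if "dom u = F" for u
          using PF that by (auto simp: content_def tile_def dom_def split: if_splits)
        have "content v (c, P) = content w (c, P)"
        proof (rule irredundant_eq)
          show "content v (c, P) \<in> tile_patterns - redundant" "content w (c, P) \<in> tile_patterns - redundant"
            using v w b(1) by (auto simp: V_def)
          have "content v (c, P) i = content w (c, P) i" if i: "i \<in> boundary reach P" for i
          proof -
            have iP: "i \<in> P" using i boundary_subset by blast
            have "i + c \<notin> tile (c', P' - boundary reach P')" if b': "(c', P') \<in> B" for c' P'
            proof
              assume t: "i + c \<in> tile (c', P' - boundary reach P')"
              have "i + c \<in> tile (c, P) \<inter> tile (c', P')" using iP t by (auto simp: mem_tile)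
              then have "(c', P') = (c, P)"
                using pack b(1) b' unfolding packings_def disjoint_family_on_def by blast
              then show False using t i by simp
            qed
            then have "i + c \<in> E" using iP PF by (auto simp: E_def exposed_def tile_def)
            then show ?thesis using eqE by (simp add: content_def)
          qed
          then show "frame (content v (c, P)) = frame (content w (c, P))"
            by (simp add: frame_def doms dom[OF v] dom[OF w] restrict_map_def fun_eq_iff)
        qed
        then have "content v (c, P) (h - c) = content w (c, P) (h - c)" by simp
        moreover have "h - c \<in> P" using b(2) by (auto simp: mem_tile)
        ultimately show ?thesis by (simp add: content_def)
      qed
    qed
    moreover have "(\<lambda>v. v |` E) ` V B \<subseteq> range (\<lambda>x :: 'g \<Rightarrow> 'a. restriction x E)"
    proof -
      have "restriction x F |` E = restriction x E" for x :: "'g \<Rightarrow> 'a"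
        using EF by (auto simp: restriction_def restrict_map_def fun_eq_iff)
      then show ?thesis by (auto simp: V_def)
    qed
    ultimately have "card (V B) \<le> card (range (\<lambda>x :: 'g \<Rightarrow> 'a. restriction x E))"
      using finite_restrictions(1)[OF finE] by (rule card_inj_on_le)
    also have "\<dots> \<le> CARD('a) ^ card E" by (rule finite_restrictions(2)[OF finE])
    also have "\<dots> \<le> CARD('a) ^ N"
      using B by (intro power_increasing) (auto simp: \<B>_def E_def Suc_le_eq)
    finally show ?thesis .
  qed
  have "card (patterns F (avoiding redundant)) \<le> card (\<Union>B\<in>\<B>. V B)"
    using sub finB finV by (intro card_mono) auto
  also have "\<dots> \<le> (\<Sum>B\<in>\<B>. card (V B))" by (rule card_UN_le[OF finB])
  also have "\<dots> \<le> (\<Sum>B\<in>\<B>. CARD('a) ^ N)" by (intro sum_mono cV)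
  also have "\<dots> = card \<B> * CARD('a) ^ N" by simp
  also have "\<dots> \<le> card (packings \<S> F) * CARD('a) ^ N"
    using finite_packings[OF F finite_shapes no_empty_shape] a_pos
    by (intro mult_right_mono card_mono) (auto simp: \<B>_def)
  finally have "real (card (patterns F (avoiding redundant))) \<le> real (card (packings \<S> F)) * real CARD('a) ^ N"
    by (simp flip: of_nat_mult of_nat_power)
  also have "\<dots> \<le> exp (2 * a * card F) * real CARD('a) ^ N"
    by (intro mult_right_mono card_packings_shapes[OF F]) auto
  finally show ?thesis .
qed

lemma avoiding_nonempty:
  assumes "X \<noteq> {}" "Q \<subseteq> redundant"
  shows "avoiding Q \<noteq> {}"
proof -
  have "finite Q" using assms(2) finite_redundant finite_subset by blast
  then show ?thesis using assms(2)
  proof (induction Q rule: finite_induct)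
    case empty
    then show ?case using assms(1) by (simp add: avoiding_empty)
  next
    case (insert p Q)
    then obtain x where x: "x \<in> avoiding Q" by blast
    show ?case
      using replace_in_tiles[OF x, of p] insert.prems by blast
  qed
qed

lemma card_collar_le:
  fixes \<epsilon> :: real
  assumes P: "finite P" and inv: "card (prodset reach P) \<le> (1 + \<epsilon>) * real (card P)"
  shows "card (boundary reach P) \<le> (card reach * \<epsilon>) * card P"
proof -
  have "P \<subseteq> prodset reach P"
    using zero_in_reach unfolding prodset_def by (metis (mono_tags, lifting) add_0 mem_Collect_eq subsetI)
  moreover have "finite (prodset reach P)" using P by (simp add: finite_prodset finite_reach)
  ultimately have "real (card (prodset reach P - P)) = real (card (prodset reach P)) - card P"
    using P by (simp add: card_Diff_subset card_mono of_nat_diff)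
  then have "real (card (prodset reach P - P)) \<le> \<epsilon> * card P" using inv by (simp add: algebra_simps)
  then have "real (card reach) * card (prodset reach P - P) \<le> card reach * (\<epsilon> * card P)"
    by (intro mult_left_mono) auto
  moreover have "real (card (boundary reach P)) \<le> real (card reach) * card (prodset reach P - P)"
    using card_boundary_le[OF finite_reach P] by (simp flip: of_nat_mult)
  ultimately show ?thesis by (simp add: mult.assoc)
qed

section \<open>Entropies along the chain\<close>

text \<open>
  Of the drop \<open>3 a\<close>, the packings account for \<open>2 a\<close>, and the values near the boundary of a late Folner set for
  at most \<open>a\<close>.
\<close>

lemma entropy_avoiding_step:
  assumes am: "amenable TYPE('g)" and Fol: "folner_sequence (F :: nat \<Rightarrow> 'g set)" and X: "X \<noteq> {}"
    and Q: "Q \<subseteq> redundant" and p: "p \<in> redundant"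
  shows "entropy (avoiding Q) \<le> entropy (avoiding (insert p Q)) + 3 * a"
proof -
  let ?Y = "avoiding Q" and ?Z = "avoiding (insert p Q)"
  have ne: "?Y \<noteq> {}" "?Z \<noteq> {}" using avoiding_nonempty[OF X] Q p by auto
  define d where "d = a / (1 + ln CARD('a))"
  have A: "real CARD('a) \<ge> 1" by (simp add: Suc_le_eq)
  then have lnA: "ln (real CARD('a)) \<ge> 0" by simp
  have pos: "1 + ln (real CARD('a)) > 0" using lnA by linarith
  then have d: "d > 0" unfolding d_def using a_pos by (intro divide_pos_pos)
  then have "d * ln CARD('a) \<le> d * (1 + ln CARD('a))" by (intro mult_left_mono) auto
  also have "\<dots> = a" using pos by (simp add: d_def)
  finally have da: "d * ln CARD('a) \<le> a" .
  have finD: "finite D" using finite_shapes shapes by (intro finite_differences) auto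
  have "\<forall>\<^sub>F m in sequentially. pattern_rate ?Y (F m) \<le> pattern_rate ?Z (F m) + 3 * a"
    using folner_boundary[OF Fol finD d] folner_nonempty[OF Fol]
  proof eventually_elim
    case (elim m)
    have fin: "finite (F m)" and w: "real (card (F m)) > 0" using elim by (auto simp: card_gt_0_iff)
    have pos: "real (card (patterns (F m) ?Y)) > 0" "real (card (patterns (F m) ?Z)) > 0"
      using card_patterns_pos[OF fin ne(1)] card_patterns_pos[OF fin ne(2)] by auto
    have "ln (card (patterns (F m) ?Y)) \<le> ln (card (patterns (F m) ?Z)
        * (exp (2 * a * card (F m)) * real CARD('a) ^ card (boundary D (F m))))"
      using card_patterns_avoiding_step[OF Q p fin] pos by (subst ln_le_cancel_iff) auto
    also have "\<dots> = ln (card (patterns (F m) ?Z)) + (2 * a * card (F m) + card (boundary D (F m)) * ln CARD('a))"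
      using pos by (simp add: ln_mult ln_realpow)
    also have "card (boundary D (F m)) * ln CARD('a) \<le> (d * card (F m)) * ln CARD('a)"
      using elim(1) lnA by (intro mult_right_mono) auto
    also have "\<dots> = (d * ln CARD('a)) * card (F m)" by simp
    also have "\<dots> \<le> a * card (F m)" using da by (intro mult_right_mono) auto
    finally show ?case using w by (simp add: pattern_rate_def field_simps)
  qed
  moreover have "(\<lambda>m. pattern_rate ?Z (F m) + 3 * a) \<longlonglongrightarrow> entropy ?Z + 3 * a"
    using entropy_limit[OF am ne(2) Fol] by (rule tendsto_add) (rule tendsto_const)
  ultimately show ?thesis
    by (intro tendsto_le[OF sequentially_bot _ entropy_limit[OF am ne(1) Fol]])
qed

text \<open>
  Apart from the packings, only exposed points contribute. Relative to the window, at most \<open>2 \<epsilon>\<close> of its points are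
  uncovered, \<open>\<epsilon>\<close> lie near its boundary, and \<open>|reach| \<epsilon>\<close> lie near the boundary of a tile.
\<close>

lemma entropy_irredundant_le:
  fixes \<epsilon> :: real
  assumes am: "amenable TYPE('g)" and Fol: "folner_sequence (F :: nat \<Rightarrow> 'g set)" and X: "X \<noteq> {}"
    and inv: "\<And>P. P \<in> \<S> \<Longrightarrow> card (prodset reach P) \<le> (1 + \<epsilon>) * real (card P)"
    and cov: "covers F (1 - 2 * \<epsilon>) \<Theta>" and eps: "\<epsilon> > 0"
  shows "entropy (avoiding redundant) \<le> 2 * a + \<epsilon> * (3 + card reach) * ln CARD('a)"
proof -
  let ?Y = "avoiding redundant"
  have ne: "?Y \<noteq> {}" using avoiding_nonempty[OF X] by auto
  have A: "real CARD('a) \<ge> 1" by (simp add: Suc_le_eq)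
  then have lnA: "ln (real CARD('a)) \<ge> 0" by simp
  have finD: "finite D" using finite_shapes shapes by (intro finite_differences) auto
  have "\<forall>\<^sub>F m in sequentially. pattern_rate ?Y (F m) \<le> 2 * a + \<epsilon> * (3 + card reach) * ln CARD('a)"
    using folner_boundary[OF Fol finD eps] folner_nonempty[OF Fol] cov[unfolded covers_def]
  proof eventually_elim
    case (elim m)
    have fin: "finite (F m)" and w: "real (card (F m)) > 0" using elim by (auto simp: card_gt_0_iff)
    define r where "r = \<epsilon> * (3 + card reach) * card (F m)"
    have r: "r \<ge> 0" using eps by (simp add: r_def)
    define N where "N = nat \<lfloor>r\<rfloor>"
    have N: "real N \<le> r" using r by (simp add: N_def)
    have "card (exposed (F m) (inner_tiles g (F m))) \<le> N" for g
    proof -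
      have "real (card (exposed (F m) (inner_tiles g (F m))))
        \<le> (1 - (1 - 2 * \<epsilon>) + card reach * \<epsilon>) * card (F m) + card (boundary D (F m))"
        using elim(3) eps shapes inv by (intro card_exposed_le[OF fin] card_collar_le) auto
      also have "\<dots> \<le> r" using elim(1) by (simp add: r_def algebra_simps)
      finally show ?thesis unfolding N_def by (simp add: le_nat_iff le_floor_iff r)
    qed
    then have "card (patterns (F m) ?Y) \<le> exp (2 * a * card (F m)) * real CARD('a) ^ N"
      by (rule card_patterns_irredundant[OF fin])
    then have "ln (card (patterns (F m) ?Y)) \<le> ln (exp (2 * a * card (F m)) * real CARD('a) ^ N)"
      using card_patterns_pos[OF fin ne] by (subst ln_le_cancel_iff) auto
    also have "\<dots> = 2 * a * card (F m) + N * ln CARD('a)"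
      by (simp add: ln_mult ln_realpow)
    also have "N * ln CARD('a) \<le> r * ln CARD('a)"
      using N lnA by (intro mult_right_mono)
    finally show ?case using w by (simp add: pattern_rate_def r_def field_simps)
  qed
  then show ?thesis
    by (rule tendsto_upperbound[OF entropy_limit[OF am ne Fol] _ sequentially_bot])
qed

text \<open>
  Take a maximal set \<open>Q\<close> of redundant patterns such that the entropy after forbidding it is still at least \<open>s\<close>.
  If \<open>Q\<close> contains all of them, then both numbers lie between 0 and \<open>\<delta>\<close>. Otherwise forbidding one more pattern
  brings the entropy below \<open>s\<close>, in a single step.
\<close>

lemma ex_avoiding_entropy_near:
  assumes am: "amenable TYPE('g)" and Fol: "folner_sequence (F :: nat \<Rightarrow> 'g set)" and X: "X \<noteq> {}"
    and s: "0 \<le> s" "s \<le> entropy X"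
    and small: "entropy (avoiding redundant) \<le> \<delta>" "3 * a \<le> \<delta>"
  obtains Q where "Q \<subseteq> redundant" "\<bar>entropy (avoiding Q) - s\<bar> \<le> \<delta>"
proof -
  define G where "G = {Q. Q \<subseteq> redundant \<and> s \<le> entropy (avoiding Q)}"
  have "{} \<in> G" using s by (simp add: G_def avoiding_empty)
  moreover have "finite G" using finite_redundant by (auto simp: G_def intro: finite_subset[of _ "Pow redundant"])
  ultimately obtain Q where Q: "Q \<in> G" and max: "\<And>R. R \<in> G \<Longrightarrow> Q \<subseteq> R \<Longrightarrow> R = Q"
    using finite_has_maximal[of G] by (metis empty_iff)
  have QR: "Q \<subseteq> redundant" "s \<le> entropy (avoiding Q)" using Q by (auto simp: G_def)
  have "entropy (avoiding Q) \<le> s + \<delta>"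
  proof (cases "Q = redundant")
    case True
    then show ?thesis using small s by simp
  next
    case False
    then obtain p where p: "p \<in> redundant" "p \<notin> Q" using QR(1) by blast
    then have "insert p Q \<notin> G" using max[of "insert p Q"] by blast
    then have "entropy (avoiding (insert p Q)) < s" using p QR by (auto simp: G_def)
    then show ?thesis using entropy_avoiding_step[OF am Fol X QR(1) p(1)] small by linarith
  qed
  then show ?thesis using QR by (intro that[of Q]) auto
qed

end

section \<open>Density of the entropies\<close>

theorem ex_subset_entropy_near:
  fixes X :: "('g::group_add \<Rightarrow> 'a::finite) set" and s \<delta> :: real
  assumes inf: "infinite (UNIV :: 'g set)" and count: "countable (UNIV :: 'g set)"
    and am: "amenable TYPE('g)" and X: "sft X" "X \<noteq> {}"
    and s: "0 \<le> s" "s \<le> entropy X" and delta: "\<delta> > 0"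
  obtains Y where "Y \<subseteq> X" "Y \<noteq> {}" "\<bar>entropy Y - s\<bar> \<le> \<delta>"
proof -
  obtain F :: "nat \<Rightarrow> 'g set" where F: "folner_sequence F" using am by (auto simp: amenable_def)
  obtain K where K: "finite K" and window: "\<And>x. (\<And>g. \<exists>y\<in>X. \<forall>k\<in>K. x (k + g) = y (k + g)) \<Longrightarrow> x \<in> X"
    using sft_window[OF X(1)] by blast
  define L where "L = insert 0 (differences {K})"
  have L: "finite L" unfolding L_def using K by (intro finite.insertI finite_differences) auto
  define a where "a = \<delta> / 4"
  define c where "c = (3 + card L) * (1 + ln CARD('a))"
  \<comment> \<open>The final entropy is at most \<open>2 a + \<epsilon> c \<le> \<delta>\<close>, and each step drops by at most \<open>3 a \<le> \<delta>\<close>.\<close>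
  define \<epsilon> where "\<epsilon> = min 1 (\<delta> / 2 / c)"
  have "real CARD('a) \<ge> 1" by (simp add: Suc_le_eq)
  then have lnA: "ln (real CARD('a)) \<ge> 0" by simp
  then have "1 + ln (real CARD('a)) > 0" by linarith
  then have c: "c > 0" unfolding c_def by (intro mult_pos_pos) auto
  have eps: "0 < \<epsilon>" "\<epsilon> \<le> 1" and a: "a > 0" using delta c by (auto simp: \<epsilon>_def a_def)
  have "\<epsilon> * c \<le> \<delta> / 2 / c * c" using c by (intro mult_right_mono) (auto simp: \<epsilon>_def)
  then have epsc: "\<epsilon> * c \<le> \<delta> / 2" using c by simp
  obtain \<Theta> where \<Theta>: "quasitiling L \<epsilon> a a \<Theta>" and cov: "covers F (1 - 2 * \<epsilon>) \<Theta>"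
    by (rule ex_quasitiling[OF inf count F L eps a])
  interpret tiled_sft X K \<Theta> a
  proof
    show "finite K" by (rule K)
    show "x \<in> X" if "\<And>g. \<exists>y\<in>X. \<forall>k\<in>K. x (k + g) = y (k + g)" for x using that by (rule window)
    show "shift g x \<in> X" if "x \<in> X" for x g using sft_shift[OF X(1) that] .
  qed (use \<Theta> a in \<open>auto simp: quasitiling_def\<close>)
  have "reach = L" by (simp add: reach_def L_def)
  have "entropy (avoiding redundant) \<le> 2 * a + \<epsilon> * (3 + card reach) * ln CARD('a)"
    using \<Theta> eps by (intro entropy_irredundant_le[OF am F X(2) _ cov]) (auto simp: quasitiling_def \<open>reach = L\<close>)
  also have "\<epsilon> * (3 + card reach) * ln CARD('a) \<le> \<epsilon> * (3 + card reach) * (1 + ln CARD('a))"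
    using eps by (intro mult_left_mono) auto
  also have "\<dots> = \<epsilon> * c" by (simp add: c_def \<open>reach = L\<close>)
  finally have small: "entropy (avoiding redundant) \<le> \<delta>" using epsc by (simp add: a_def)
  have "3 * a \<le> \<delta>" using delta by (simp add: a_def)
  then obtain Q where Q: "Q \<subseteq> redundant" "\<bar>entropy (avoiding Q) - s\<bar> \<le> \<delta>"
    by (rule ex_avoiding_entropy_near[OF am F X(2) s small])
  show ?thesis by (rule that[OF avoiding_subset avoiding_nonempty[OF X(2) Q(1)] Q(2)])
qed

text \<open>
  The entropy of the outer approximation for \<open>F\<close> is at most its quotient at the window \<open>F\<close>, which is that of \<open>Y\<close>.
\<close>

lemma ex_sft_between:
  fixes X Y :: "('g::group_add \<Rightarrow> 'a::finite) set"
  assumes am: "amenable TYPE('g)" and X: "sft X" and Y: "Y \<subseteq> X" "Y \<noteq> {}" and d: "\<delta> > 0"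
  obtains Z where "sft Z" "Z \<subseteq> X" "entropy Y \<le> entropy Z" "entropy Z < entropy Y + \<delta>"
proof -
  obtain F :: "nat \<Rightarrow> 'g set" where F: "folner_sequence F" using am by (auto simp: amenable_def)
  have "\<forall>\<^sub>F m in sequentially. pattern_rate Y (F m) < entropy Y + \<delta>"
    using entropy_limit[OF am Y(2) F] d by (intro order_tendstoD(2)) auto
  with folner_nonempty[OF F] have "\<forall>\<^sub>F m in sequentially. finite (F m) \<and> F m \<noteq> {} \<and> pattern_rate Y (F m) < entropy Y + \<delta>"
    by eventually_elim auto
  then obtain m where m: "finite (F m)" "F m \<noteq> {}" "pattern_rate Y (F m) < entropy Y + \<delta>"
    using eventually_happens'[OF sequentially_bot] by blast
  obtain Z where Z: "sft Z" "Y \<subseteq> Z" "Z \<subseteq> X" "patterns (F m) Z = patterns (F m) Y"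
    by (rule sft_outer_approximation[OF X Y(1) m(1)])
  have "Z \<noteq> {}" using Z(2) Y(2) by blast
  then have "entropy Z \<le> pattern_rate Z (F m)" using entropy_le_rate[OF am _ m(1,2)] by blast
  also have "\<dots> = pattern_rate Y (F m)" by (simp add: pattern_rate_def Z(4))
  finally show ?thesis using that[OF Z(1,3)] entropy_mono[OF am Z(2)] m(3) by auto
qed

theorem theorem4p1:
  fixes X :: "('g::group_add \<Rightarrow> 'a::finite) set"
  assumes "infinite (UNIV :: 'g set)" and "countable (UNIV :: 'g set)"
    and "amenable TYPE('g)"
    and "sft X" and "entropy X > 0"
  shows "{entropy Y |Y. Y \<subseteq> X \<and> sft Y} \<subseteq> {0..entropy X} \<and>
         {0..entropy X} \<subseteq> closure {entropy Y |Y. Y \<subseteq> X \<and> sft Y}"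
proof (intro conjI subsetI)
  fix t assume "t \<in> {entropy Y |Y. Y \<subseteq> X \<and> sft Y}"
  then show "t \<in> {0..entropy X}"
    using entropy_nonneg[OF assms(3)] entropy_mono[OF assms(3)] by auto
next
  fix s assume s: "s \<in> {0..entropy X}"
  have X: "X \<noteq> {}" using assms(5) by (auto simp: entropy_def)
  show "s \<in> closure {entropy Y |Y. Y \<subseteq> X \<and> sft Y}"
    unfolding closure_approachable
  proof (intro allI impI)
    fix e :: real assume e: "e > 0"
    then have e2: "e / 2 > 0" by simp
    obtain Y where Y: "Y \<subseteq> X" "Y \<noteq> {}" "\<bar>entropy Y - s\<bar> \<le> e / 2"
      by (rule ex_subset_entropy_near[OF assms(1-4) X _ _ e2, of s]) (use s in auto)
    obtain Z where Z: "sft Z" "Z \<subseteq> X" "entropy Y \<le> entropy Z" "entropy Z < entropy Y + e / 2"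
      by (rule ex_sft_between[OF assms(3,4) Y(1,2) e2])
    then have "dist (entropy Z) s < e" using Y(3) unfolding dist_real_def by linarith
    then show "\<exists>t\<in>{entropy Y |Y. Y \<subseteq> X \<and> sft Y}. dist t s < e"
      using Z(1,2) by blast
  qed
qed

end
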